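(* Let $\Omega\subseteq\mathbb{R}^N$ be a bounded domain with Lipschitz boundary, $s\in(0,1)$, $p\in[1,\infty)$, $q\in[1,\infty]$, and let $g\in L^{p'}(\Omega,\mathbb{C})$ with $\int_\Omega g=1$, where $\frac1p+\frac1{p'}=1$. Assume further that one of the following three conditions holds: (i) $sp<N$ and $q\le\frac{Np}{N-sp}$; (ii) $sp=N$ and $q<\infty$; (iii) $sp>N$ and $q\le\infty$. Then there exists a constant $C=C(\Omega,g,p,q,s)>0$ such that for every $f\in W^{s,p}(\Omega,\mathbb{C})$ $$\left\|f-\int_\Omega fg\right\|_{L^q(\Omega,\mathbb{C})}\le C\,[f]_{W^{s,p}(\Omega,\mathbb{C})}.$$
   Context: A domain is a connected open set. For $s\in(0,1)$, $p\in[1,\infty)$ and an open set $\Omega\subseteq\mathbb{R}^N$, $$[f]_{W^{s,p}(\Omega,\mathbb{C})}:=\left(\iint_{\Omega\times\Omega}\frac{|f(x)-f(y)|^p}{|x-y|^{N+sp}}\,dx\,dy\right)^{1/p},$$ and $W^{s,p}(\Omega,\mathbb{C})$ is the space of $f\in L^p(\Omega,\mathbb{C})$ with $[f]_{W^{s,p}(\Omega,\mathbb{C})}<\infty$. *)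

theory Defs
  imports "HOL-Probability.Essential_Supremum"
begin

text \<open>
  Near every boundary point, \<open>\<Omega>\<close> is, after a rotation of the coordinate axes, the region strictly
  above the graph of a Lipschitz function. The unit vector \<open>v\<close> is the last coordinate direction, and
  the graph function \<open>\<gamma>\<close> is only relevant on the hyperplane orthogonal to \<open>v\<close>; it may be evaluated at
  \<open>y - (y \<bullet> v) *\<^sub>R v\<close>, the orthogonal projection of \<open>y\<close> to that hyperplane.
\<close>

definition lipschitz_boundary :: "'a::euclidean_space set \<Rightarrow> bool" where
  "lipschitz_boundary \<Omega> \<longleftrightarrow>
     (\<forall>x\<in>frontier \<Omega>. \<exists>r>0. \<exists>v L. \<exists>\<gamma>::'a \<Rightarrow> real.
        norm v = 1 \<and> L-lipschitz_on {z. z \<bullet> v = 0} \<gamma> \<and>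
        \<Omega> \<inter> ball x r = {y \<in> ball x r. y \<bullet> v > \<gamma> (y - (y \<bullet> v) *\<^sub>R v)})"

definition root_ennreal :: "real \<Rightarrow> ennreal \<Rightarrow> ennreal" where
  "root_ennreal p a = (if a = \<infinity> then \<infinity> else ennreal (enn2real a powr (1 / p)))"

text \<open>
  The norm is extended-valued: it is \<open>\<infinity>\<close> on measurable functions outside \<open>L\<^sup>q\<close>.
\<close>

definition Lp_norm :: "'a measure \<Rightarrow> ennreal \<Rightarrow> ('a \<Rightarrow> complex) \<Rightarrow> ennreal" where
  "Lp_norm M q f =
     (if q = \<infinity> then esssup M (\<lambda>x. ennreal (norm (f x)))
      else root_ennreal (enn2real q) (\<integral>\<^sup>+x. ennreal (norm (f x) powr enn2real q) \<partial>M))"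

definition Lp_space :: "'a measure \<Rightarrow> ennreal \<Rightarrow> ('a \<Rightarrow> complex) set" where
  "Lp_space M q = {f \<in> borel_measurable M. Lp_norm M q f < \<infinity>}"

text \<open>
  On the diagonal the integrand is \<open>0\<close>, since \<open>0 powr p = 0\<close> and \<open>0 / 0 = 0\<close>; the diagonal is a
  null set.
\<close>

definition gagliardo_seminorm ::
  "real \<Rightarrow> real \<Rightarrow> 'a::euclidean_space set \<Rightarrow> ('a \<Rightarrow> complex) \<Rightarrow> ennreal" where
  "gagliardo_seminorm s p \<Omega> f =
     root_ennreal p
       (\<integral>\<^sup>+(x, y). ennreal (norm (f x - f y) powr p / norm (x - y) powr (real DIM('a) + s * p))
          \<partial>(lebesgue_on \<Omega> \<Otimes>\<^sub>M lebesgue_on \<Omega>))"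

text \<open>
  Functions on \<open>\<Omega>\<close> are total functions whose values off \<open>\<Omega>\<close> are irrelevant, and almost everywhere
  equal functions are not identified.
\<close>

definition frac_sobolev ::
  "real \<Rightarrow> real \<Rightarrow> 'a::euclidean_space set \<Rightarrow> ('a \<Rightarrow> complex) set" where
  "frac_sobolev s p \<Omega> =
     {f \<in> Lp_space (lebesgue_on \<Omega>) (ennreal p). gagliardo_seminorm s p \<Omega> f < \<infinity>}"

end

theory Submission
  imports Defs
begin

text \<open>
  Write \<open>N = DIM('a)\<close>, \<open>c\<^sub>0 = \<integral> f g\<close>, \<open>u = norm (f - c\<^sub>0)\<close>, and
  \<open>U x = \<integral> norm (f x - f y) powr p / norm (x - y) powr (N + s p) dy\<close>. Since \<open>\<integral> g = 1\<close>,
  \<open>f x - c\<^sub>0 = \<integral> (f x - f y) g y dy\<close>, so Hoelder's inequality and the boundedness of \<open>\<Omega>\<close> give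
  \<open>\<integral> u powr p \<le> K * \<integral> U\<close>.

  The boundary regularity enters only through the measure density condition
  \<open>measure (\<Omega> \<inter> ball x r) \<ge> c * r powr N\<close> for \<open>r \<le> R\<close>. If \<open>{u > l}\<close> has measure at most
  \<open>c / 2 * r powr N\<close> and \<open>u x \<ge> l + h\<close>, then \<open>u\<close> stays \<open>h\<close> below \<open>u x\<close> on half of \<open>\<Omega> \<inter> ball x r\<close>,
  whence \<open>h powr p \<le> 2 / c * r powr (s p) * U x\<close>.

  For \<open>s p < N\<close> and the critical exponent \<open>q\<close>, take \<open>l = h = u x / 2\<close> and let \<open>r\<close> be the radius that
  Markov's inequality for \<open>A = \<integral> u powr q\<close> permits; this turns the estimate into
  \<open>u x powr q \<le> C * A powr (s p / N) * U x\<close>, and integrating gives \<open>A powr (p / q) \<le> C * \<integral> U\<close>. For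
  \<open>s p > N\<close>, iterating the estimate over radii \<open>R / 2 ^ k\<close> bounds \<open>u\<close> almost everywhere.
\<close>

section \<open>Measure density of Lipschitz domains\<close>

text \<open>Near a frontier point the ball is found by moving \<open>x\<close> by \<open>r/2\<close>
  in the direction \<open>v\<close>. The new point is more than \<open>r/2\<close> above the graph.
  A perturbation of norm below \<open>c * r\<close> lowers its height by less than
  \<open>c * r\<close> and raises the graph by at most \<open>L * c * r\<close>, so a small
  \<open>c\<close> keeps it in \<open>\<Omega>\<close>. If \<open>z\<close> is in
  \<open>\<Omega>\<close>, small balls lie in \<open>\<Omega>\<close> outright and
  \<open>c = 1\<close> works.\<close>

lemma lipschitz_boundary_interior_ball_local:
  fixes \<Omega> :: "'a::euclidean_space set"
  assumes "open \<Omega>" and "lipschitz_boundary \<Omega>" and "z \<in> closure \<Omega>"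
  shows "\<exists>\<rho>>0. \<exists>c>0. \<forall>x\<in>\<Omega> \<inter> ball z \<rho>. \<forall>r. 0 < r \<and> r \<le> \<rho> \<longrightarrow>
           (\<exists>w. ball w (c * r) \<subseteq> \<Omega> \<inter> ball x r)"
proof (cases "z \<in> \<Omega>")
  case True
  then obtain e where e: "e > 0" "ball z e \<subseteq> \<Omega>"
    using \<open>open \<Omega>\<close> open_contains_ball by blast
  have "\<exists>w. ball w (1 * r) \<subseteq> \<Omega> \<inter> ball x r" if "x \<in> ball z (e/2)" "r \<le> e/2" for x r
  proof -
    have "ball x r \<subseteq> ball z e"
    proof
      fix y assume "y \<in> ball x r"
      then show "y \<in> ball z e"
        using that dist_triangle[of z y x] by simp
    qed
    then show ?thesis using e(2) by auto
  qed
  then show ?thesis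
    using e(1) by (intro exI[of _ "e/2"] conjI exI[of _ 1]) auto
next
  case False
  then have "z \<in> frontier \<Omega>"
    using assms by (simp add: frontier_def interior_open)
  from bspec[OF assms(2)[unfolded lipschitz_boundary_def] this]
  obtain \<rho> v L \<gamma> where \<rho>: "\<rho> > 0" and v: "norm v = 1"
    and L: "L-lipschitz_on {z. z \<bullet> v = 0} (\<gamma> :: 'a \<Rightarrow> real)"
    and eq: "\<Omega> \<inter> ball z \<rho> = {y \<in> ball z \<rho>. y \<bullet> v > \<gamma> (y - (y \<bullet> v) *\<^sub>R v)}"
    by (elim exE conjE)
  have L0: "L \<ge> 0" using L lipschitz_on_nonneg by blast
  have vv: "v \<bullet> v = 1" using v by (simp add: dot_square_norm)
  \<comment> \<open>This value gives \<open>(L + 1) * c < 1/2\<close>, which keeps the ball above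
    the graph, and \<open>c \<le> 1/4\<close>, which keeps it inside
    \<open>ball x r\<close>.\<close>
  define c where "c = 1 / (2 * (L + 2))"
  have c: "c > 0" "c \<le> 1/4" "L * c < 1/2 - c"
    using L0 by (auto simp: c_def field_simps)
  \<comment> \<open>Halving \<open>\<rho>\<close> keeps every point within distance \<open>r\<close>
    of \<open>x\<close> inside \<open>ball z \<rho>\<close>, where the graph describes
    \<open>\<Omega>\<close>.\<close>
  have "ball (x + (r/2) *\<^sub>R v) (c * r) \<subseteq> \<Omega> \<inter> ball x r"
    if x: "x \<in> \<Omega>" "x \<in> ball z (\<rho>/2)" and r: "0 < r" "r \<le> \<rho>/2" for x r
  proof
    fix y assume y: "y \<in> ball (x + (r/2) *\<^sub>R v) (c * r)"
    define u where "u = y - x - (r/2) *\<^sub>R v"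
    have y_eq: "y = x + (r/2) *\<^sub>R v + u" by (simp add: u_def)
    have u: "norm u < c * r"
      using y by (simp add: y_eq dist_norm)
    have cr: "c * r \<le> r/4" using mult_right_mono[OF c(2), of r] r(1) by simp
    have "norm (y - x) \<le> r/2 + norm u"
      unfolding y_eq using norm_triangle_ineq[of "(r/2) *\<^sub>R v" u] v r(1) by simp
    then have yx: "norm (y - x) < r" using u cr r(1) by linarith
    have yz: "y \<in> ball z \<rho>"
      using yx x(2) r dist_triangle[of z y x] by (simp add: dist_norm norm_minus_commute)
    define x' y' where "x' = x - (x \<bullet> v) *\<^sub>R v" and "y' = y - (y \<bullet> v) *\<^sub>R v"
    have mem: "x' \<in> {z. z \<bullet> v = 0}" "y' \<in> {z. z \<bullet> v = 0}"
      by (simp_all add: x'_def y'_def inner_diff_left vv)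
    have yxu: "y' - x' = u - (u \<bullet> v) *\<^sub>R v"
      by (simp add: x'_def y'_def y_eq algebra_simps inner_add_left vv)
    \<comment> \<open>By Pythagoras, removing the \<open>v\<close> component does not increase the
      norm, so the graph height changes by at most \<open>L * norm u\<close>.\<close>
    have "(norm (u - (u \<bullet> v) *\<^sub>R v))\<^sup>2 = (norm u)\<^sup>2 - (u \<bullet> v)\<^sup>2"
      unfolding power2_norm_eq_inner
      by (simp add: inner_diff_left inner_diff_right vv inner_commute power2_eq_square)
    then have "(norm (u - (u \<bullet> v) *\<^sub>R v))\<^sup>2 \<le> (norm u)\<^sup>2" by simp
    then have "norm (y' - x') \<le> norm u"
      unfolding yxu by (rule power2_le_imp_le) simp
    then have "\<gamma> y' - \<gamma> x' \<le> L * norm u"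
      using lipschitz_onD[OF L mem(2) mem(1)] mult_left_mono[OF _ L0, of "norm (y' - x')" "norm u"]
      by (simp add: dist_norm)
    also have "\<dots> \<le> L * c * r"
      using mult_left_mono[OF less_imp_le[OF u] L0] by (simp add: mult.assoc)
    also have "\<dots> < (1/2 - c) * r" using c(3) r(1) by simp
    also have "\<dots> < r/2 + u \<bullet> v"
      using u Cauchy_Schwarz_ineq2[of u v] v by (simp add: algebra_simps)
    also have "\<dots> = y \<bullet> v - x \<bullet> v"
      by (simp add: y_eq inner_add_left vv)
    finally have "\<gamma> y' - \<gamma> x' < y \<bullet> v - x \<bullet> v" .
    moreover have "x \<bullet> v > \<gamma> x'"
    proof -
      have "x \<in> \<Omega> \<inter> ball z \<rho>" using x \<rho> by auto
      then show ?thesis unfolding eq x'_def by blast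
    qed
    ultimately have "y \<in> \<Omega> \<inter> ball z \<rho>"
      unfolding eq using yz by (simp add: y'_def)
    then show "y \<in> \<Omega> \<inter> ball x r"
      using yx by (simp add: dist_norm norm_minus_commute)
  qed
  then have "\<forall>x\<in>\<Omega> \<inter> ball z (\<rho>/2). \<forall>r. 0 < r \<and> r \<le> \<rho>/2 \<longrightarrow>
      (\<exists>w. ball w (c * r) \<subseteq> \<Omega> \<inter> ball x r)" by blast
  moreover have "\<rho>/2 > 0" using \<rho> by simp
  ultimately show ?thesis using c(1) by blast
qed

text \<open>Compactness of \<open>closure \<Omega>\<close> makes the local constants uniform:
  finitely many of the local balls cover it, and the minima of their constants serve every
  \<open>x\<close>.\<close>

lemma lipschitz_boundary_interior_ball:
  fixes \<Omega> :: "'a::euclidean_space set"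
  assumes "open \<Omega>" and "bounded \<Omega>" and "lipschitz_boundary \<Omega>"
  obtains c R :: real where "c > 0" and "R > 0"
    and "\<And>x r. x \<in> \<Omega> \<Longrightarrow> 0 < r \<Longrightarrow> r \<le> R \<Longrightarrow> \<exists>w. ball w (c * r) \<subseteq> \<Omega> \<inter> ball x r"
proof -
  have "\<forall>z\<in>closure \<Omega>. \<exists>\<rho> c. \<rho> > 0 \<and> c > 0 \<and> (\<forall>x\<in>\<Omega> \<inter> ball z \<rho>. \<forall>r. 0 < r \<and> r \<le> \<rho> \<longrightarrow>
           (\<exists>w. ball w (c * r) \<subseteq> \<Omega> \<inter> ball x r))"
    using lipschitz_boundary_interior_ball_local[OF assms(1,3)] by meson
  then obtain \<rho> c where \<rho>c: "\<And>z. z \<in> closure \<Omega> \<Longrightarrow> \<rho> z > 0 \<and> c z > (0::real) \<and>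
      (\<forall>x\<in>\<Omega> \<inter> ball z (\<rho> z). \<forall>r. 0 < r \<and> r \<le> \<rho> z \<longrightarrow> (\<exists>w. ball w (c z * r) \<subseteq> \<Omega> \<inter> ball x r))"
    by metis
  have "compact (closure \<Omega>)" using assms(2) by simp
  then obtain Z where Z: "Z \<subseteq> closure \<Omega>" "finite Z" "closure \<Omega> \<subseteq> (\<Union>z\<in>Z. ball z (\<rho> z))"
    by (rule compactE_image[of _ "closure \<Omega>" "\<lambda>z. ball z (\<rho> z)"]) (use \<rho>c in auto)
  \<comment> \<open>The inserted \<open>1\<close> keeps both minima well defined when
    \<open>Z\<close> is empty.\<close>
  define c' where "c' = Min (insert 1 (c ` Z))"
  define R where "R = Min (insert 1 (\<rho> ` Z))"
  have "c' > 0" "R > 0"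
    using Z \<rho>c by (auto simp: c'_def R_def subset_iff)
  moreover have "\<exists>w. ball w (c' * r) \<subseteq> \<Omega> \<inter> ball x r" if "x \<in> \<Omega>" "0 < r" "r \<le> R" for x r
  proof -
    obtain z where z: "z \<in> Z" "x \<in> ball z (\<rho> z)"
      using Z(3) \<open>x \<in> \<Omega>\<close> closure_subset by blast
    have "c' \<le> c z" "R \<le> \<rho> z"
      using z Z(2) by (auto simp: c'_def R_def)
    moreover have "z \<in> closure \<Omega>" using z Z(1) by blast
    ultimately have "\<forall>x\<in>\<Omega> \<inter> ball z (\<rho> z). \<forall>r. 0 < r \<and> r \<le> \<rho> z \<longrightarrow>
        (\<exists>w. ball w (c z * r) \<subseteq> \<Omega> \<inter> ball x r)"
      using \<rho>c by blast
    from bspec[OF this, of x] z(2) that \<open>R \<le> \<rho> z\<close>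
    obtain w where w: "ball w (c z * r) \<subseteq> \<Omega> \<inter> ball x r" by auto
    have "ball w (c' * r) \<subseteq> ball w (c z * r)"
      using \<open>c' \<le> c z\<close> \<open>0 < r\<close> by (intro subset_ball mult_right_mono) auto
    then show ?thesis using w by blast
  qed
  ultimately show ?thesis using that by blast
qed

text \<open>The volume of the interior ball of radius \<open>c * r\<close> is a fixed multiple of
  \<open>r ^ N\<close>. All later estimates see the boundary only through this volume bound.\<close>

lemma lipschitz_boundary_measure_density:
  fixes \<Omega> :: "'a::euclidean_space set"
  assumes "open \<Omega>" and "bounded \<Omega>" and "lipschitz_boundary \<Omega>"
  obtains c R :: real where "c > 0" and "R > 0"
    and "\<And>x r. x \<in> \<Omega> \<Longrightarrow> 0 < r \<Longrightarrow> r \<le> R \<Longrightarrow>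
           ennreal (c * r powr DIM('a)) \<le> emeasure (lebesgue_on \<Omega>) (\<Omega> \<inter> ball x r)"
proof -
  obtain c R :: real where c: "c > 0" and R: "R > 0"
    and ball: "\<And>x r. x \<in> \<Omega> \<Longrightarrow> 0 < r \<Longrightarrow> r \<le> R \<Longrightarrow> \<exists>w. ball w (c * r) \<subseteq> \<Omega> \<inter> ball x r"
    using lipschitz_boundary_interior_ball[OF assms] by blast
  have \<Omega>: "\<Omega> \<in> sets lebesgue" using assms(1) by auto
  define c' where "c' = unit_ball_vol (real DIM('a)) * c ^ DIM('a)"
  have "c' > 0" using c unit_ball_vol_pos[of "real DIM('a)"] by (simp add: c'_def)
  moreover have "ennreal (c' * r powr DIM('a)) \<le> emeasure (lebesgue_on \<Omega>) (\<Omega> \<inter> ball x r)"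
    if x: "x \<in> \<Omega>" "0 < r" "r \<le> R" for x r
  proof -
    obtain w where w: "ball w (c * r) \<subseteq> \<Omega> \<inter> ball x r" using ball[OF x] by blast
    have "ennreal (c' * r powr DIM('a)) = emeasure lebesgue (ball w (c * r))"
      using c x by (simp add: emeasure_ball c'_def power_mult_distrib powr_realpow mult.assoc)
    also have "\<dots> \<le> emeasure lebesgue (\<Omega> \<inter> ball x r)"
      using w \<Omega> by (intro emeasure_mono) auto
    also have "\<dots> = emeasure (lebesgue_on \<Omega>) (\<Omega> \<inter> ball x r)"
      using \<Omega> by (subst emeasure_restrict_space) auto
    finally show ?thesis .
  qed
  ultimately show ?thesis using that R by blast
qed

section \<open>The inner integral of the Gagliardo seminorm\<close>

text \<open>The codomain is general because the energy is taken both of the complex function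
  \<open>f\<close> and of the real function \<open>norm (f - c\<^sub>0)\<close>.\<close>

definition frac_energy ::
  "real \<Rightarrow> real \<Rightarrow> 'a::euclidean_space set \<Rightarrow> ('a \<Rightarrow> 'b::real_normed_vector) \<Rightarrow> 'a \<Rightarrow> ennreal" where
  "frac_energy s p \<Omega> f x =
     (\<integral>\<^sup>+y. ennreal (norm (f x - f y) powr p / norm (x - y) powr (real DIM('a) + s * p))
        \<partial>lebesgue_on \<Omega>)"

text \<open>Composition with a 1-Lipschitz map does not increase the energy. This is applied to
  truncations and to the passage from \<open>f\<close> to
  \<open>norm (f - c\<^sub>0)\<close>.\<close>

lemma frac_energy_mono:
  assumes "\<And>y. norm (u x - u y) \<le> norm (f x - f y)" and "0 \<le> p"
  shows "frac_energy s p \<Omega> u x \<le> frac_energy s p \<Omega> f x"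
  unfolding frac_energy_def using assms
  by (intro nn_integral_mono ennreal_leI divide_right_mono powr_mono2) auto

lemma measurable_ident_lebesgue_on:
  "(\<lambda>x. x) \<in> borel_measurable (lebesgue_on (\<Omega> :: 'a::euclidean_space set))"
  by (rule measurable_restrict_space1) (rule measurable_completion, simp)

lemma measurable_frac_kernel:
  fixes f :: "'a::euclidean_space \<Rightarrow> 'b::{real_normed_vector, second_countable_topology}"
  assumes [measurable]: "f \<in> borel_measurable (lebesgue_on \<Omega>)"
  shows "(\<lambda>(x, y). ennreal (norm (f x - f y) powr p / norm (x - y) powr e))
           \<in> borel_measurable (lebesgue_on \<Omega> \<Otimes>\<^sub>M lebesgue_on \<Omega>)"
proof -
  note measurable_ident_lebesgue_on[measurable]
  show ?thesis by measurable
qed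

lemma measurable_frac_kernel_snd:
  fixes f :: "'a::euclidean_space \<Rightarrow> 'b::{real_normed_vector, second_countable_topology}"
  assumes [measurable]: "f \<in> borel_measurable (lebesgue_on \<Omega>)"
  shows "(\<lambda>y. ennreal (norm (f x - f y) powr p / norm (x - y) powr e))
           \<in> borel_measurable (lebesgue_on \<Omega>)"
proof -
  note measurable_ident_lebesgue_on[measurable]
  show ?thesis by measurable
qed

lemma measurable_frac_energy:
  fixes f :: "'a::euclidean_space \<Rightarrow> 'b::{real_normed_vector, second_countable_topology}"
  assumes "\<Omega> \<in> lmeasurable" and "f \<in> borel_measurable (lebesgue_on \<Omega>)"
  shows "frac_energy s p \<Omega> f \<in> borel_measurable (lebesgue_on \<Omega>)"
proof -
  interpret finite_measure "lebesgue_on \<Omega>"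
    using assms(1) by (rule finite_measure_lebesgue_on)
  show ?thesis
    unfolding frac_energy_def[abs_def]
    by (rule borel_measurable_nn_integral) (rule measurable_frac_kernel[OF assms(2)])
qed

text \<open>Tonelli's theorem; it lets pointwise bounds by the energy be integrated to bounds by the
  seminorm.\<close>

lemma nn_integral_frac_energy:
  fixes f :: "'a::euclidean_space \<Rightarrow> 'b::{real_normed_vector, second_countable_topology}"
  assumes "\<Omega> \<in> lmeasurable" and "f \<in> borel_measurable (lebesgue_on \<Omega>)"
  shows "(\<integral>\<^sup>+x. frac_energy s p \<Omega> f x \<partial>lebesgue_on \<Omega>) =
     (\<integral>\<^sup>+(x, y). ennreal (norm (f x - f y) powr p / norm (x - y) powr (real DIM('a) + s * p))
          \<partial>(lebesgue_on \<Omega> \<Otimes>\<^sub>M lebesgue_on \<Omega>))"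
proof -
  interpret finite_measure "lebesgue_on \<Omega>"
    using assms(1) by (rule finite_measure_lebesgue_on)
  show ?thesis
    unfolding frac_energy_def
    by (subst nn_integral_fst[OF measurable_frac_kernel[OF assms(2)], symmetric]) simp
qed

section \<open>Markov's inequality for superlevel sets\<close>

lemma ennreal_le_divideI:
  assumes "0 < a" and "ennreal a * x \<le> ennreal b"
  shows "x \<le> ennreal (b / a)"
proof (cases x)
  case (real r)
  then have "ennreal (a * r) \<le> ennreal b"
    using assms by (simp add: ennreal_mult)
  \<comment> \<open>\<open>ennreal\<close> sends a negative \<open>b\<close> to \<open>0\<close>, in
    which case the hypothesis forces \<open>a * r = 0\<close>.\<close>
  then have "a * r \<le> b \<or> a * r = 0 \<and> b \<le> 0"
    using real assms(1) by (auto simp: ennreal_le_iff2 mult_le_0_iff)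
  then show ?thesis
    using real assms(1) by (auto simp: field_simps ennreal_leI)
next
  case top
  then show ?thesis using assms by (simp add: ennreal_mult_top top_unique)
qed

text \<open>Markov's inequality. The sign of \<open>u\<close> is free: \<open>u\<close> exceeds
  \<open>t > 0\<close> on the superlevel set, and \<open>powr\<close> is nonnegative
  elsewhere.\<close>

lemma emeasure_superlevel_le:
  assumes "\<Omega> \<in> sets lebesgue" and [measurable]: "u \<in> borel_measurable (lebesgue_on \<Omega>)"
    and "0 < t" "0 < e"
    and B: "(\<integral>\<^sup>+x. ennreal (u x powr e) \<partial>lebesgue_on \<Omega>) \<le> ennreal B"
  shows "emeasure (lebesgue_on \<Omega>) {x\<in>\<Omega>. t < u x} \<le> ennreal (B / t powr e)"
proof -
  have "{x\<in>\<Omega>. t < u x} \<in> sets (lebesgue_on \<Omega>)"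
    using assms(2)[unfolded borel_measurable_iff_greater] by (simp add: space_restrict_space)
  note [measurable] = this
  have te: "t powr e > 0" using \<open>0 < t\<close> by simp
  have "ennreal (t powr e) * emeasure (lebesgue_on \<Omega>) {x\<in>\<Omega>. t < u x}
      = (\<integral>\<^sup>+x. ennreal (t powr e) * indicator {x\<in>\<Omega>. t < u x} x \<partial>lebesgue_on \<Omega>)"
    by (simp add: nn_integral_cmult_indicator)
  also have "\<dots> \<le> (\<integral>\<^sup>+x. ennreal (u x powr e) \<partial>lebesgue_on \<Omega>)"
    using assms by (intro nn_integral_mono) (auto simp: indicator_def intro!: ennreal_leI powr_mono2)
  finally have "ennreal (t powr e) * emeasure (lebesgue_on \<Omega>) {x\<in>\<Omega>. t < u x} \<le> ennreal B"
    using B by order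
  then show ?thesis by (rule ennreal_le_divideI[OF te])
qed

section \<open>Hoelder and Poincare inequalities\<close>

text \<open>With this the estimates run on integrals of powers, and roots appear only when entering
  and leaving them.\<close>

lemma root_ennreal_le_iff:
  assumes "0 < p" and "0 \<le> b"
  shows "root_ennreal p a \<le> ennreal b \<longleftrightarrow> a \<le> ennreal (b powr p)"
proof (cases a)
  case (real r)
  have "r powr (1 / p) \<le> b \<longleftrightarrow> r \<le> b powr p"
  proof
    assume "r powr (1 / p) \<le> b"
    then have "(r powr (1 / p)) powr p \<le> b powr p" using assms by (intro powr_mono2) auto
    then show "r \<le> b powr p" using real assms by (simp add: powr_powr)
  next
    assume "r \<le> b powr p"
    then have "r powr (1 / p) \<le> (b powr p) powr (1 / p)" using real assms by (intro powr_mono2) auto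
    then show "r powr (1 / p) \<le> b" using assms by (simp add: powr_powr)
  qed
  then show ?thesis using real assms by (simp add: root_ennreal_def)
qed (simp add: root_ennreal_def top_unique)

lemma root_ennreal_finite_iff: "root_ennreal p a < \<infinity> \<longleftrightarrow> a < \<infinity>"
  by (auto simp: root_ennreal_def less_top)

text \<open>The two kernels differ by the factor \<open>norm (x - y) powr ((s - s') * p)\<close>,
  which is at most \<open>D powr ((s - s') * p)\<close> on a set of diameter at most
  \<open>D\<close>.\<close>

lemma frac_energy_lower_order:
  fixes f :: "'a::euclidean_space \<Rightarrow> 'b::{real_normed_vector, second_countable_topology}"
  assumes f: "f \<in> borel_measurable (lebesgue_on \<Omega>)"
    and D: "\<And>x y. x \<in> \<Omega> \<Longrightarrow> y \<in> \<Omega> \<Longrightarrow> norm (x - y) \<le> D"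
    and x: "x \<in> \<Omega>" and s: "s' \<le> s" "0 \<le> p"
  shows "frac_energy s' p \<Omega> f x \<le> ennreal (D powr ((s - s') * p)) * frac_energy s p \<Omega> f x"
proof -
  have "norm (f x - f y) powr p / norm (x - y) powr (real DIM('a) + s' * p) \<le>
     D powr ((s - s') * p) * (norm (f x - f y) powr p / norm (x - y) powr (real DIM('a) + s * p))"
    if y: "y \<in> \<Omega>" for y
  proof (cases "x = y")
    case False
    have "norm (x - y) powr ((s - s') * p) \<le> D powr ((s - s') * p)"
      using D[OF x y] s by (intro powr_mono2) auto
    then have "norm (x - y) powr ((s - s') * p) *
        (norm (f x - f y) powr p / norm (x - y) powr (real DIM('a) + s * p)) \<le>
      D powr ((s - s') * p) * (norm (f x - f y) powr p / norm (x - y) powr (real DIM('a) + s * p))"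
      by (rule mult_right_mono) simp
    moreover have "real DIM('a) + s * p = (real DIM('a) + s' * p) + (s - s') * p"
      by (simp add: algebra_simps)
    then have "norm (x - y) powr (real DIM('a) + s * p) =
        norm (x - y) powr (real DIM('a) + s' * p) * norm (x - y) powr ((s - s') * p)"
      by (simp only: powr_add)
    ultimately show ?thesis using False by simp
  qed simp
  then have "frac_energy s' p \<Omega> f x \<le> (\<integral>\<^sup>+y. ennreal (D powr ((s - s') * p)) *
      ennreal (norm (f x - f y) powr p / norm (x - y) powr (real DIM('a) + s * p)) \<partial>lebesgue_on \<Omega>)"
    unfolding frac_energy_def
    by (intro nn_integral_mono)
      (auto simp: space_restrict_space simp flip: ennreal_mult' intro!: ennreal_leI)
  also have "\<dots> = ennreal (D powr ((s - s') * p)) * frac_energy s p \<Omega> f x"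
    unfolding frac_energy_def by (rule nn_integral_cmult) (rule measurable_frac_kernel_snd[OF f])
  finally show ?thesis .
qed

text \<open>
  Young's inequality is applied to \<open>\<phi> / \<alpha> powr (1 / p)\<close> and \<open>g\<close>, so that both factors have
  norms bounded independently of \<open>\<phi>\<close>.
\<close>

lemma Lp_pairing_bound:
  fixes g :: "'a \<Rightarrow> complex"
  assumes p: "1 \<le> p" and conj: "1 / ennreal p + 1 / p' = 1" and g: "g \<in> Lp_space M p'"
  shows "\<exists>K>0. \<forall>\<phi> :: 'a \<Rightarrow> complex. \<forall>\<alpha>>0. \<phi> \<in> borel_measurable M \<longrightarrow>
     (\<integral>\<^sup>+x. ennreal (norm (\<phi> x) powr p) \<partial>M) \<le> ennreal \<alpha> \<longrightarrow>
     (\<integral>\<^sup>+x. ennreal (norm (\<phi> x * g x)) \<partial>M) \<le> ennreal (K * \<alpha> powr (1 / p))"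
proof (cases "p = 1")
  case True
  have gm[measurable]: "g \<in> borel_measurable M" using g by (simp add: Lp_space_def)
  have "1 / p' = 0"
    using conj True by (cases "1 / p'") (auto simp flip: ennreal_plus ennreal_1)
  then have "p' = \<infinity>" by (simp add: ennreal_divide_eq_0_iff)
  then have "esssup M (\<lambda>x. ennreal (norm (g x))) < \<infinity>"
    using g by (simp add: Lp_space_def Lp_norm_def)
  then obtain G where G: "0 \<le> G" "esssup M (\<lambda>x. ennreal (norm (g x))) = ennreal G"
    by (cases "esssup M (\<lambda>x. ennreal (norm (g x)))") auto
  \<comment> \<open>Adding \<open>1\<close> keeps the constant positive when \<open>g\<close>
    vanishes almost everywhere.\<close>
  define L where "L = G + 1"
  have L: "L > 0" using G by (simp add: L_def)
  have AE: "AE x in M. norm (g x) \<le> L"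
    using esssup_AE[of "\<lambda>x. ennreal (norm (g x))" M] unfolding G(2)
    by eventually_elim (use G in \<open>simp add: L_def\<close>)
  have "(\<integral>\<^sup>+x. ennreal (norm (\<phi> x * g x)) \<partial>M) \<le> ennreal (L * \<alpha> powr (1 / p))"
    if "\<alpha> > 0" and [measurable]: "\<phi> \<in> borel_measurable M"
      and int: "(\<integral>\<^sup>+x. ennreal (norm (\<phi> x) powr p) \<partial>M) \<le> ennreal \<alpha>"
    for \<phi> :: "'a \<Rightarrow> complex" and \<alpha>
  proof -
    have "(\<integral>\<^sup>+x. ennreal (norm (\<phi> x * g x)) \<partial>M) \<le>
        (\<integral>\<^sup>+x. ennreal L * ennreal (norm (\<phi> x) powr p) \<partial>M)"
    proof (rule nn_integral_mono_AE)
      show "AE x in M. ennreal (norm (\<phi> x * g x)) \<le> ennreal L * ennreal (norm (\<phi> x) powr p)"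
        using AE
      proof eventually_elim
        case (elim x)
        then have "norm (g x) * norm (\<phi> x) \<le> L * norm (\<phi> x)"
          by (rule mult_right_mono) simp
        then show ?case
          using L True by (simp add: norm_mult mult.commute flip: ennreal_mult)
      qed
    qed
    also have "\<dots> \<le> ennreal L * ennreal \<alpha>"
      by (subst nn_integral_cmult) (auto intro!: mult_left_mono int)
    finally show ?thesis using L True \<open>\<alpha> > 0\<close> by (simp add: ennreal_mult)
  qed
  then show ?thesis using L by (intro exI[of _ L]) auto
next
  case False
  then have p: "p > 1" using p by simp
  have gm[measurable]: "g \<in> borel_measurable M" using g by (simp add: Lp_space_def)
  have inv_p: "1 / ennreal p = ennreal (1 / p)" using p by (simp add: divide_ennreal flip: ennreal_1)
  have "p' \<noteq> \<infinity>"
  proof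
    assume "p' = \<infinity>"
    then show False using conj inv_p p by (simp add: ennreal_eq_1)
  qed
  moreover have "p' \<noteq> 0"
    using conj by (auto simp: ennreal_divide_zero)
  ultimately obtain r where r: "p' = ennreal r" "r > 0"
    by (cases p') (auto simp: less_le)
  have "ennreal (1 / p + 1 / r) = 1"
    using conj r p inv_p by (simp add: divide_ennreal ennreal_plus flip: ennreal_1)
  then have pr: "1 / p + 1 / r = 1" by (simp add: ennreal_eq_1)
  have "1 / p > 0" using p by simp
  then have r1: "r > 1" using pr r(2) by (smt (verit) divide_less_eq_1_pos)
  have "(\<integral>\<^sup>+x. ennreal (norm (g x) powr r) \<partial>M) < \<infinity>"
    using g r by (simp add: Lp_space_def Lp_norm_def root_ennreal_finite_iff[unfolded infinity_ennreal_def])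
  then obtain \<beta> where \<beta>: "0 \<le> \<beta>" "(\<integral>\<^sup>+x. ennreal (norm (g x) powr r) \<partial>M) = ennreal \<beta>"
    by (cases "\<integral>\<^sup>+x. ennreal (norm (g x) powr r) \<partial>M") auto
  have "(\<integral>\<^sup>+x. ennreal (norm (\<phi> x * g x)) \<partial>M) \<le> ennreal ((1 + \<beta>) * \<alpha> powr (1 / p))"
    if \<alpha>: "\<alpha> > 0" and [measurable]: "\<phi> \<in> borel_measurable M"
      and int: "(\<integral>\<^sup>+x. ennreal (norm (\<phi> x) powr p) \<partial>M) \<le> ennreal \<alpha>"
    for \<phi> :: "'a \<Rightarrow> complex" and \<alpha>
  proof -
    \<comment> \<open>Dividing by \<open>a\<close> normalises \<open>\<phi>\<close>: the integral of
      \<open>(norm (\<phi> x) / a) powr p\<close> is at most \<open>1\<close>.\<close>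
    define a where "a = \<alpha> powr (1 / p)"
    have a: "a > 0" "a powr p = \<alpha>" using \<alpha> p by (auto simp: a_def powr_powr)
    have young: "norm (\<phi> x * g x) \<le> a / \<alpha> * norm (\<phi> x) powr p + a * norm (g x) powr r" for x
    proof -
      have "(norm (\<phi> x) / a) * norm (g x) \<le> (norm (\<phi> x) / a) powr p / p + norm (g x) powr r / r"
        using Youngs_inequality[of p r "norm (\<phi> x) / a" "norm (g x)"] p r1 pr a by simp
      also have "\<dots> \<le> (norm (\<phi> x) / a) powr p / 1 + norm (g x) powr r / 1"
        using p r1 by (intro add_mono divide_left_mono) auto
      also have "\<dots> = norm (\<phi> x) powr p / \<alpha> + norm (g x) powr r"
        using a by (simp add: powr_divide)
      finally have "a * ((norm (\<phi> x) / a) * norm (g x)) \<le> a * (norm (\<phi> x) powr p / \<alpha> + norm (g x) powr r)"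
        using a by (intro mult_left_mono) auto
      then show ?thesis using a by (simp add: norm_mult algebra_simps)
    qed
    have "(\<integral>\<^sup>+x. ennreal (norm (\<phi> x * g x)) \<partial>M) \<le>
        (\<integral>\<^sup>+x. ennreal (a / \<alpha>) * ennreal (norm (\<phi> x) powr p) + ennreal a * ennreal (norm (g x) powr r) \<partial>M)"
      using young a \<alpha> by (intro nn_integral_mono) (simp flip: ennreal_mult ennreal_plus)
    also have "\<dots> = ennreal (a / \<alpha>) * (\<integral>\<^sup>+x. ennreal (norm (\<phi> x) powr p) \<partial>M) + ennreal a * ennreal \<beta>"
      by (simp add: nn_integral_add nn_integral_cmult \<beta>)
    also have "\<dots> \<le> ennreal (a / \<alpha>) * ennreal \<alpha> + ennreal a * ennreal \<beta>"
      by (intro add_mono mult_left_mono int) auto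
    also have "\<dots> = ennreal (a / \<alpha> * \<alpha> + a * \<beta>)"
      using a \<alpha> \<beta> by (simp flip: ennreal_mult)
    also have "a / \<alpha> * \<alpha> + a * \<beta> = (1 + \<beta>) * \<alpha> powr (1 / p)"
      using \<alpha> by (simp add: a_def algebra_simps)
    finally show ?thesis .
  qed
  then show ?thesis using \<beta>(1) by (intro exI[of _ "1 + \<beta>"]) auto
qed

text \<open>The pairing bound is applied, for each fixed \<open>x\<close>, to
  \<open>y \<mapsto> f x - f y\<close>. Its constant depends only on \<open>g\<close> and
  \<open>p\<close>, so integrating over \<open>x\<close> gives a bound uniform in \<open>f\<close>.
  The kernel enters through \<open>norm (x - y) \<le> D\<close>, which makes it at least
  \<open>1 / E\<close> times the numerator.\<close>

lemma fractional_poincare: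
  fixes \<Omega> :: "'a::euclidean_space set" and g :: "'a \<Rightarrow> complex"
  assumes \<Omega>: "\<Omega> \<in> lmeasurable"
    and D: "0 < D" "\<And>x y. x \<in> \<Omega> \<Longrightarrow> y \<in> \<Omega> \<Longrightarrow> norm (x - y) \<le> D"
    and s: "0 \<le> s" and p: "1 \<le> p" and conj: "1 / ennreal p + 1 / p' = 1"
    and g: "g \<in> Lp_space (lebesgue_on \<Omega>) p'" and g1: "(LINT x|lebesgue_on \<Omega>. g x) = 1"
  shows "\<exists>K>0. \<forall>f \<in> Lp_space (lebesgue_on \<Omega>) (ennreal p).
     (\<integral>\<^sup>+x. ennreal (norm (f x - (LINT y|lebesgue_on \<Omega>. f y * g y)) powr p) \<partial>lebesgue_on \<Omega>)
       \<le> ennreal K * (\<integral>\<^sup>+x. frac_energy s p \<Omega> f x \<partial>lebesgue_on \<Omega>)"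
proof -
  let ?X = "lebesgue_on \<Omega>"
  obtain K where K: "K > 0" and pairing: "\<And>(\<phi> :: 'a \<Rightarrow> complex) \<alpha>. \<alpha> > 0 \<Longrightarrow>
     \<phi> \<in> borel_measurable ?X \<Longrightarrow> (\<integral>\<^sup>+x. ennreal (norm (\<phi> x) powr p) \<partial>?X) \<le> ennreal \<alpha> \<Longrightarrow>
     (\<integral>\<^sup>+x. ennreal (norm (\<phi> x * g x)) \<partial>?X) \<le> ennreal (K * \<alpha> powr (1 / p))"
    using Lp_pairing_bound[OF p conj g] by blast
  have gm[measurable]: "g \<in> borel_measurable ?X" using g by (simp add: Lp_space_def)
  \<comment> \<open>A non-integrable function has Bochner integral \<open>0\<close>, so the value
    \<open>1\<close> forces integrability.\<close>
  have gi: "integrable ?X g" using g1 not_integrable_integral_eq by fastforce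
  define E where "E = D powr (real DIM('a) + s * p)"
  have E: "E > 0" using D by (simp add: E_def)
  have "(\<integral>\<^sup>+x. ennreal (norm (f x - (LINT y|?X. f y * g y)) powr p) \<partial>?X)
       \<le> ennreal (K powr p * E) * (\<integral>\<^sup>+x. frac_energy s p \<Omega> f x \<partial>?X)"
    if f: "f \<in> Lp_space ?X (ennreal p)" for f
  proof -
    let ?c = "LINT y|?X. f y * g y"
    have fm[measurable]: "f \<in> borel_measurable ?X" using f by (simp add: Lp_space_def)
    have "(\<integral>\<^sup>+x. ennreal (norm (f x) powr p) \<partial>?X) < \<infinity>"
      using f p by (simp add: Lp_space_def Lp_norm_def root_ennreal_finite_iff[unfolded infinity_ennreal_def])
    then obtain a where a: "0 \<le> a" "(\<integral>\<^sup>+x. ennreal (norm (f x) powr p) \<partial>?X) = ennreal a"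
      by (cases "\<integral>\<^sup>+x. ennreal (norm (f x) powr p) \<partial>?X") auto
    \<comment> \<open>Integrability of \<open>f * g\<close> ensures that \<open>?c\<close> is a
      genuine integral and not the default \<open>0\<close>. The summand \<open>1\<close> provides
      the positive bound that \<open>pairing\<close> requires.\<close>
    have "(\<integral>\<^sup>+x. ennreal (norm (f x * g x)) \<partial>?X) \<le> ennreal (K * (a + 1) powr (1 / p))"
      using a by (intro pairing) auto
    also have "\<dots> < \<infinity>" by simp
    finally have fgi: "integrable ?X (\<lambda>y. f y * g y)"
      by (intro integrableI_bounded) auto
    have pointwise: "ennreal (norm (f x - ?c) powr p) \<le>
        ennreal (K powr p) * (\<integral>\<^sup>+y. ennreal (norm (f x - f y) powr p) \<partial>?X)" for x
    proof (cases "\<integral>\<^sup>+y. ennreal (norm (f x - f y) powr p) \<partial>?X")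
      case (real b)
      have "norm (f x - ?c) powr p \<le> K powr p * b + \<epsilon>" if \<epsilon>: "\<epsilon> > 0" for \<epsilon>
      proof -
        \<comment> \<open>\<open>b\<close> may be \<open>0\<close> but \<open>pairing\<close> needs
          a positive bound; the slack contributes exactly \<open>\<epsilon>\<close> after
          multiplication by \<open>K powr p\<close>.\<close>
        define \<alpha> where "\<alpha> = b + \<epsilon> / K powr p"
        have \<alpha>: "\<alpha> > 0" "b \<le> \<alpha>" using real \<epsilon> K by (auto simp: \<alpha>_def add_nonneg_pos)
        have "(\<integral>y. (f x - f y) * g y \<partial>?X) = (\<integral>y. f x * g y - f y * g y \<partial>?X)"
          by (simp add: left_diff_distrib)
        also have "\<dots> = f x - ?c"
          using gi fgi g1 by simp
        finally have eq: "(\<integral>y. (f x - f y) * g y \<partial>?X) = f x - ?c" .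
        have "integrable ?X (\<lambda>y. (f x - f y) * g y)"
          using gi fgi by (simp add: left_diff_distrib)
        from integral_norm_bound_ennreal[OF this]
        have "ennreal (norm (f x - ?c)) \<le> (\<integral>\<^sup>+y. ennreal (norm ((f x - f y) * g y)) \<partial>?X)"
          unfolding eq .
        also have "\<dots> \<le> ennreal (K * \<alpha> powr (1 / p))"
          using \<alpha> real by (intro pairing) (auto intro: ennreal_leI)
        finally have "norm (f x - ?c) \<le> K * \<alpha> powr (1 / p)"
          using K by (subst (asm) ennreal_le_iff) auto
        then have "norm (f x - ?c) powr p \<le> (K * \<alpha> powr (1 / p)) powr p"
          using p by (intro powr_mono2) auto
        also have "\<dots> = K powr p * \<alpha>"
          using K \<alpha> p by (simp add: powr_mult powr_powr)
        also have "\<dots> = K powr p * b + \<epsilon>" using K by (simp add: \<alpha>_def distrib_left)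
        finally show ?thesis .
      qed
      then have "norm (f x - ?c) powr p \<le> K powr p * b" by (rule field_le_epsilon)
      then show ?thesis using real by (simp add: ennreal_leI flip: ennreal_mult)
    next
      case top
      then show ?thesis using K by (simp add: ennreal_mult_top)
    qed
    have kernel: "(\<integral>\<^sup>+y. ennreal (norm (f x - f y) powr p) \<partial>?X) \<le> ennreal E * frac_energy s p \<Omega> f x"
      if x: "x \<in> \<Omega>" for x
    proof -
      have "norm (f x - f y) powr p
          \<le> E * (norm (f x - f y) powr p / norm (x - y) powr (real DIM('a) + s * p))"
        if y: "y \<in> \<Omega>" for y
      proof (cases "x = y")
        case False
        have "norm (x - y) powr (real DIM('a) + s * p) \<le> E"
          unfolding E_def using D(2)[OF x y] s p by (intro powr_mono2) auto
        then have "norm (x - y) powr (real DIM('a) + s * p) * norm (f x - f y) powr p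
            \<le> E * norm (f x - f y) powr p"
          by (rule mult_right_mono) simp
        then show ?thesis
          using False by (simp add: pos_le_divide_eq mult.commute)
      qed simp
      then have "(\<integral>\<^sup>+y. ennreal (norm (f x - f y) powr p) \<partial>?X) \<le>
         (\<integral>\<^sup>+y. ennreal E * ennreal (norm (f x - f y) powr p / norm (x - y) powr (real DIM('a) + s * p)) \<partial>?X)"
        using E by (intro nn_integral_mono)
          (auto simp: space_restrict_space simp flip: ennreal_mult' intro!: ennreal_leI)
      also have "\<dots> = ennreal E * frac_energy s p \<Omega> f x"
        unfolding frac_energy_def
        by (rule nn_integral_cmult) (rule measurable_frac_kernel_snd[OF fm])
      finally show ?thesis .
    qed
    have "(\<integral>\<^sup>+x. ennreal (norm (f x - ?c) powr p) \<partial>?X) \<le>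
        (\<integral>\<^sup>+x. ennreal (K powr p * E) * frac_energy s p \<Omega> f x \<partial>?X)"
    proof (rule nn_integral_mono)
      fix x assume "x \<in> space ?X"
      then have "x \<in> \<Omega>" by (simp add: space_restrict_space)
      have "ennreal (norm (f x - ?c) powr p) \<le> ennreal (K powr p) * (ennreal E * frac_energy s p \<Omega> f x)"
        using pointwise[of x] mult_left_mono[OF kernel[OF \<open>x \<in> \<Omega>\<close>], of "ennreal (K powr p)"] by simp
      then show "ennreal (norm (f x - ?c) powr p) \<le> ennreal (K powr p * E) * frac_energy s p \<Omega> f x"
        using E by (simp add: ennreal_mult mult.assoc)
    qed
    also have "\<dots> = ennreal (K powr p * E) * (\<integral>\<^sup>+x. frac_energy s p \<Omega> f x \<partial>?X)"
      by (rule nn_integral_cmult) (rule measurable_frac_energy[OF \<Omega> fm])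
    finally show ?thesis .
  qed
  moreover have "K powr p * E > 0" using K E by simp
  ultimately show ?thesis by blast
qed

section \<open>Sobolev inequalities under the measure density condition\<close>

locale measure_density =
  fixes \<Omega> :: "'a::euclidean_space set" and c R :: real
  assumes lmeasurable: "\<Omega> \<in> lmeasurable"
    and c_pos: "0 < c" and R_pos: "0 < R"
    and density: "\<And>x r. x \<in> \<Omega> \<Longrightarrow> 0 < r \<Longrightarrow> r \<le> R \<Longrightarrow>
           ennreal (c * r powr DIM('a)) \<le> emeasure (lebesgue_on \<Omega>) (\<Omega> \<inter> ball x r)"
begin

lemma sets_lebesgue: "\<Omega> \<in> sets lebesgue"
  using lmeasurable by auto

lemma emeasure_space_finite: "emeasure (lebesgue_on \<Omega>) (space (lebesgue_on \<Omega>)) < \<infinity>"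
  using finite_measure.emeasure_finite[OF finite_measure_lebesgue_on[OF lmeasurable]]
  by (simp add: top.not_eq_extremum)

text \<open>
  At least half of \<open>\<Omega> \<inter> ball x r\<close> lies in the sublevel set \<open>{u \<le> l}\<close>, where \<open>u\<close> differs from
  \<open>u x\<close> by at least \<open>h\<close>.
\<close>

lemma frac_energy_ge_level_gap:
  fixes u :: "'a \<Rightarrow> real"
  assumes u[measurable]: "u \<in> borel_measurable (lebesgue_on \<Omega>)"
    and x: "x \<in> \<Omega>" "l + h \<le> u x" "0 < h" and r: "0 < r" "r \<le> R"
    and level: "emeasure (lebesgue_on \<Omega>) {y\<in>\<Omega>. l < u y} \<le> ennreal (c / 2 * r powr DIM('a))"
    and sp: "0 \<le> s" "0 \<le> p"
  shows "ennreal (h powr p) \<le> ennreal (2 / c * r powr (s * p)) * frac_energy s p \<Omega> u x"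
proof -
  let ?X = "lebesgue_on \<Omega>" and ?N = "real DIM('a)"
  define E where "E = {y \<in> \<Omega> \<inter> ball x r. u y \<le> l}"
  have sp_X: "space ?X = \<Omega>" by (simp add: space_restrict_space)
  have ball: "\<Omega> \<inter> ball x r \<in> sets ?X"
    using sets_lebesgue by (subst sets_restrict_space_iff) auto
  have gt: "{y\<in>\<Omega>. l < u y} \<in> sets ?X"
    using u[unfolded borel_measurable_iff_greater] by (simp add: sp_X)
  have "E = (\<Omega> \<inter> ball x r) - {y\<in>\<Omega>. l < u y}" by (auto simp: E_def)
  then have E[measurable]: "E \<in> sets ?X" using ball gt by auto
  \<comment> \<open>Finiteness of this measure allows the subadditivity estimate to be rearranged in
    the reals.\<close>
  have "emeasure ?X E \<le> emeasure ?X (space ?X)"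
    by (rule emeasure_space)
  also have "\<dots> < \<infinity>"
    by (rule emeasure_space_finite)
  finally obtain e where e: "0 \<le> e" "emeasure ?X E = ennreal e"
    by (cases "emeasure ?X E") auto
  have "ennreal (c * r powr ?N) \<le> emeasure ?X (\<Omega> \<inter> ball x r)"
    by (rule density) fact+
  also have "\<dots> \<le> emeasure ?X (E \<union> {y\<in>\<Omega>. l < u y})"
    by (rule emeasure_mono) (use E gt in \<open>auto simp: E_def\<close>)
  also have "\<dots> \<le> emeasure ?X E + emeasure ?X {y\<in>\<Omega>. l < u y}"
    by (rule emeasure_subadditive) fact+
  also have "\<dots> \<le> ennreal e + ennreal (c / 2 * r powr ?N)"
    using e level by (intro add_mono) auto
  also have "\<dots> = ennreal (e + c / 2 * r powr ?N)"
    using e c_pos by (subst ennreal_plus) auto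
  finally have "c * r powr ?N \<le> e + c / 2 * r powr ?N"
    using e c_pos by (subst (asm) ennreal_le_iff) auto
  then have e_ge: "c / 2 * r powr ?N \<le> e" by simp
  \<comment> \<open>A lower bound for the kernel on \<open>E\<close>: the numerator is at least
    \<open>h powr p\<close>, and the distance is at most \<open>r\<close>.\<close>
  define k where "k = h powr p / r powr (?N + s * p)"
  have "k \<ge> 0" by (simp add: k_def)
  have kernel: "k \<le> norm (u x - u y) powr p / norm (x - y) powr (?N + s * p)" if "y \<in> E" for y
  proof -
    have "norm (u x - u y) \<ge> h" using that x by (auto simp: E_def)
    moreover have "x \<noteq> y" using that x by (auto simp: E_def)
    moreover have "norm (x - y) \<le> r" using that by (auto simp: E_def dist_norm)
    ultimately show ?thesis
      unfolding k_def using x sp r by (intro frac_le powr_mono2) auto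
  qed
  have "ennreal (k * e) = (\<integral>\<^sup>+y. ennreal k * indicator E y \<partial>?X)"
    using e \<open>k \<ge> 0\<close> by (simp add: nn_integral_cmult_indicator ennreal_mult)
  also have "\<dots> \<le> frac_energy s p \<Omega> u x"
    unfolding frac_energy_def
    by (intro nn_integral_mono) (use kernel in \<open>auto simp: indicator_def intro!: ennreal_leI\<close>)
  finally have U: "ennreal (k * e) \<le> frac_energy s p \<Omega> u x" .
  have "h powr p = 2 / c * r powr (s * p) * (k * (c / 2 * r powr ?N))"
    using c_pos r by (simp add: k_def powr_add field_simps)
  also have "\<dots> \<le> 2 / c * r powr (s * p) * (k * e)"
    using e_ge c_pos \<open>k \<ge> 0\<close> by (intro mult_left_mono) auto
  finally have "ennreal (h powr p) \<le> ennreal (2 / c * r powr (s * p) * (k * e))"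
    by (rule ennreal_leI)
  also have "\<dots> = ennreal (2 / c * r powr (s * p)) * ennreal (k * e)"
    using c_pos by (intro ennreal_mult') simp
  also have "\<dots> \<le> ennreal (2 / c * r powr (s * p)) * frac_energy s p \<Omega> u x"
    by (rule mult_left_mono[OF U]) simp
  finally show ?thesis .
qed

text \<open>
  The radius \<open>r\<close> is chosen such that Markov's inequality for \<open>u powr q\<close> bounds the measure of
  \<open>{u > u x / 2}\<close> by exactly the amount that the level gap estimate allows. If this radius exceeds
  \<open>R\<close>, Markov's inequality for \<open>u powr p\<close> takes over at radius \<open>R\<close>, unless \<open>u x\<close> is small.
\<close>

lemma critical_pointwise_bound:
  fixes u :: "'a \<Rightarrow> real"
  assumes u[measurable]: "u \<in> borel_measurable (lebesgue_on \<Omega>)" and u0: "0 \<le> u x"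
    and x: "x \<in> \<Omega>" and s: "0 < s" and p: "1 \<le> p" and sp: "s * p < real DIM('a)"
    and q: "q = real DIM('a) * p / (real DIM('a) - s * p)"
    and A: "(\<integral>\<^sup>+x. ennreal (u x powr q) \<partial>lebesgue_on \<Omega>) \<le> ennreal A" "0 < A"
    and M: "(\<integral>\<^sup>+x. ennreal (u x powr p) \<partial>lebesgue_on \<Omega>) \<le> ennreal M" "0 \<le> M"
  shows "ennreal (u x powr q) \<le>
      ennreal (2 powr p * (2 / c) * (2 powr (q + 1) / c) powr (s * p / real DIM('a)) *
        A powr (s * p / real DIM('a))) * frac_energy s p \<Omega> u x +
      ennreal ((2 powr (p + 1) * M / (c * R powr real DIM('a))) powr (q / p))"
proof (cases "u x = 0")
  case True
  then show ?thesis by simp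
next
  case False
  define F where "F = u x"
  define N where "N = real DIM('a)"
  define \<kappa> where "\<kappa> = s * p / N"
  define B where "B = 2 powr (q + 1) * A / (c * F powr q)"
  define r where "r = B powr (1 / N)"
  let ?U = "frac_energy s p \<Omega> u x"
  have F: "F > 0" using False u0 by (simp add: F_def)
  have N: "N > 0" by (simp add: N_def)
  have q0: "q > 0" using p sp N by (simp add: q N_def)
  \<comment> \<open>The scaling identity behind the critical exponent:
    \<open>r powr (s * p) = B powr \<kappa>\<close> carries the factor
    \<open>F powr (p - q)\<close>, which cancels \<open>F powr (q - p)\<close> in
    \<open>main\<close>.\<close>
  have q\<kappa>: "q * \<kappa> = q - p"
    using sp N unfolding q \<kappa>_def N_def[symmetric] by (simp add: field_simps)
  have B: "B > 0" using A(2) c_pos F by (simp add: B_def)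
  have r0: "r > 0" using B by (simp add: r_def)
  have rN: "r powr N = B" using N B by (simp add: r_def powr_powr)
  have r\<kappa>: "r powr (s * p) = B powr \<kappa>" by (simp add: r_def powr_powr \<kappa>_def)
  have main: "ennreal (F powr q) \<le>
      ennreal (2 powr p * (2 / c) * (2 powr (q + 1) / c) powr \<kappa> * A powr \<kappa>) * ?U"
    if *: "ennreal ((F / 2) powr p) \<le> ennreal (2 / c * r powr (s * p)) * ?U"
  proof -
    have "F powr q = F powr p * F powr (q - p)" by (simp add: powr_add[symmetric])
    then have "F powr q = (2 powr p * F powr (q - p)) * (F / 2) powr p"
      using F by (simp add: powr_divide)
    then have "ennreal (F powr q) = ennreal (2 powr p * F powr (q - p)) * ennreal ((F / 2) powr p)"
      by (simp add: ennreal_mult')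
    also have "\<dots> \<le> ennreal (2 powr p * F powr (q - p)) * (ennreal (2 / c * r powr (s * p)) * ?U)"
      by (rule mult_left_mono[OF *]) simp
    also have "\<dots> = ennreal (2 powr p * F powr (q - p) * (2 / c * r powr (s * p))) * ?U"
      using c_pos by (subst ennreal_mult) (auto simp: mult.assoc)
    also have "2 powr p * F powr (q - p) * (2 / c * r powr (s * p)) =
        2 powr p * (2 / c) * (2 powr (q + 1) / c) powr \<kappa> * A powr \<kappa>"
    proof -
      have "B = (2 powr (q + 1) / c) * A / F powr q" by (simp add: B_def)
      then have "r powr (s * p) = (2 powr (q + 1) / c) powr \<kappa> * A powr \<kappa> / F powr (q - p)"
        using c_pos A(2) F by (simp add: r\<kappa> powr_divide powr_mult powr_powr q\<kappa>[symmetric])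
      then show ?thesis using F by simp
    qed
    finally show ?thesis .
  qed
  have "ennreal (F powr q) \<le>
      ennreal (2 powr p * (2 / c) * (2 powr (q + 1) / c) powr \<kappa> * A powr \<kappa>) * ?U \<or>
    F powr q \<le> (2 powr (p + 1) * M / (c * R powr N)) powr (q / p)"
  proof (cases "r \<le> R")
    case True
    have "emeasure (lebesgue_on \<Omega>) {y\<in>\<Omega>. F / 2 < u y} \<le> ennreal (A / (F / 2) powr q)"
      using F q0 A by (intro emeasure_superlevel_le sets_lebesgue u) auto
    also have "A / (F / 2) powr q = c / 2 * r powr N"
      using c_pos F by (simp add: rN B_def powr_divide powr_add)
    finally have "ennreal ((F / 2) powr p) \<le> ennreal (2 / c * r powr (s * p)) * ?U"
      using True r0 F x s p unfolding N_def
      by (intro frac_energy_ge_level_gap[where l = "F / 2"] u) (auto simp: F_def)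
    then show ?thesis using main by blast
  next
    case False
    show ?thesis
    proof (cases "M / (F / 2) powr p \<le> c / 2 * R powr N")
      case True
      have "emeasure (lebesgue_on \<Omega>) {y\<in>\<Omega>. F / 2 < u y} \<le> ennreal (M / (F / 2) powr p)"
        using F p M by (intro emeasure_superlevel_le sets_lebesgue u) auto
      also have "\<dots> \<le> ennreal (c / 2 * R powr N)" by (rule ennreal_leI[OF True])
      finally have "ennreal ((F / 2) powr p) \<le> ennreal (2 / c * R powr (s * p)) * ?U"
        using R_pos F x s p unfolding N_def
        by (intro frac_energy_ge_level_gap[where l = "F / 2"] u) (auto simp: F_def)
      \<comment> \<open>Since \<open>r > R\<close>, replacing \<open>R\<close> by \<open>r\<close>
        only enlarges the right side, and \<open>main\<close> applies again.\<close>
      also have "\<dots> \<le> ennreal (2 / c * r powr (s * p)) * ?U"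
        using False R_pos c_pos s p
        by (intro mult_right_mono ennreal_leI mult_left_mono powr_mono2) auto
      finally show ?thesis using main by blast
    next
      case False
      \<comment> \<open>Here Markov's inequality at radius \<open>R\<close> is too weak, which
        itself bounds \<open>F powr p\<close> by a multiple of \<open>M\<close>.\<close>
      then have "c / 2 * R powr N * (F / 2) powr p < M"
        using F by (simp add: pos_less_divide_eq not_le)
      then have "F powr p \<le> 2 powr (p + 1) * M / (c * R powr N)"
        using c_pos R_pos F by (simp add: powr_divide powr_add field_simps)
      then have "(F powr p) powr (q / p) \<le> (2 powr (p + 1) * M / (c * R powr N)) powr (q / p)"
        using q0 p by (intro powr_mono2) auto
      then show ?thesis using p by (simp add: powr_powr)
    qed
  qed
  then show ?thesis
    unfolding F_def N_def \<kappa>_def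
  proof
    assume "ennreal (u x powr q) \<le> ennreal (2 powr p * (2 / c) *
      (2 powr (q + 1) / c) powr (s * p / real DIM('a)) * A powr (s * p / real DIM('a))) * ?U"
    then show ?thesis by (rule add_increasing2[OF zero_le])
  next
    assume "u x powr q \<le> (2 powr (p + 1) * M / (c * R powr real DIM('a))) powr (q / p)"
    then show ?thesis by (intro add_increasing[OF zero_le] ennreal_leI)
  qed
qed

text \<open>
  Boundedness of \<open>u\<close> makes \<open>A = \<integral> u powr q\<close> finite, so that \<open>A\<close> can be absorbed in
  \<open>A \<le> C * A powr (s * p / N) * \<sigma> + C * \<sigma> powr (q / p)\<close>.
\<close>

lemma critical_bound_bounded:
  assumes s: "0 < s" and p: "1 \<le> p" and sp: "s * p < real DIM('a)"
    and q: "q = real DIM('a) * p / (real DIM('a) - s * p)" and K: "0 \<le> K"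
  shows "\<exists>C>0. \<forall>u :: 'a \<Rightarrow> real. \<forall>T \<sigma>. u \<in> borel_measurable (lebesgue_on \<Omega>) \<longrightarrow>
     (\<forall>x. 0 \<le> u x \<and> u x \<le> T) \<longrightarrow> 0 < \<sigma> \<longrightarrow>
     (\<integral>\<^sup>+x. frac_energy s p \<Omega> u x \<partial>lebesgue_on \<Omega>) \<le> ennreal \<sigma> \<longrightarrow>
     (\<integral>\<^sup>+x. ennreal (u x powr p) \<partial>lebesgue_on \<Omega>) \<le> ennreal (K * \<sigma>) \<longrightarrow>
     (\<integral>\<^sup>+x. ennreal (u x powr q) \<partial>lebesgue_on \<Omega>) \<le> ennreal (C * \<sigma> powr (q / p))"
proof -
  let ?X = "lebesgue_on \<Omega>"
  define N where "N = real DIM('a)"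
  define \<kappa> where "\<kappa> = s * p / N"
  define m where "m = enn2real (emeasure ?X (space ?X))"
  have m: "emeasure ?X (space ?X) = ennreal m" "0 \<le> m"
    using emeasure_space_finite by (auto simp: m_def less_top)
  define C1 where "C1 = 2 powr p * (2 / c) * (2 powr (q + 1) / c) powr \<kappa>"
  define C2 where "C2 = 2 powr (p + 1) / (c * R powr N) * K"
  define C where "C = (2 * C1) powr (q / p) + 2 * m * C2 powr (q / p)"
  have N: "N > 0" by (simp add: N_def)
  have C1: "C1 > 0" using c_pos by (simp add: C1_def)
  have C2: "C2 \<ge> 0" using c_pos R_pos K by (simp add: C2_def)
  have C: "C > 0" using C1 m(2) by (auto simp: C_def intro: add_pos_nonneg)
  have q0: "q > 0" using p sp by (simp add: q)
  \<comment> \<open>Raising \<open>A powr (1 - \<kappa>) \<le> 2 * C1 * \<sigma>\<close> to the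
    power \<open>q / p\<close> therefore recovers \<open>A\<close> itself.\<close>
  have q1: "(1 - \<kappa>) * (q / p) = 1"
    using sp N p unfolding q \<kappa>_def N_def[symmetric] by (simp add: field_simps)
  have "(\<integral>\<^sup>+x. ennreal (u x powr q) \<partial>?X) \<le> ennreal (C * \<sigma> powr (q / p))"
    if u[measurable]: "u \<in> borel_measurable ?X" and u0: "\<forall>x. 0 \<le> u x \<and> u x \<le> T" and \<sigma>: "0 < \<sigma>"
      and U: "(\<integral>\<^sup>+x. frac_energy s p \<Omega> u x \<partial>?X) \<le> ennreal \<sigma>"
      and M: "(\<integral>\<^sup>+x. ennreal (u x powr p) \<partial>?X) \<le> ennreal (K * \<sigma>)"
    for u :: "'a \<Rightarrow> real" and T \<sigma>
  proof -
    have "(\<integral>\<^sup>+x. ennreal (u x powr q) \<partial>?X) \<le> (\<integral>\<^sup>+x. ennreal (T powr q) \<partial>?X)"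
      using u0 q0 by (intro nn_integral_mono ennreal_leI powr_mono2) auto
    also have "\<dots> < \<infinity>"
      using emeasure_space_finite by (simp add: ennreal_mult_less_top)
    finally obtain A where A: "0 \<le> A" "(\<integral>\<^sup>+x. ennreal (u x powr q) \<partial>?X) = ennreal A"
      by (cases "(\<integral>\<^sup>+x. ennreal (u x powr q) \<partial>?X)") auto
    show ?thesis
    proof (cases "A = 0")
      case True
      then show ?thesis using A by simp
    next
      case False
      then have A0: "A > 0" using A by simp
      have [measurable]: "frac_energy s p \<Omega> u \<in> borel_measurable ?X"
        by (rule measurable_frac_energy[OF lmeasurable u])
      have const: "2 powr (p + 1) * (K * \<sigma>) / (c * R powr N) = C2 * \<sigma>"
        by (simp add: C2_def)
      have "ennreal A \<le> (\<integral>\<^sup>+x. ennreal (C1 * A powr \<kappa>) * frac_energy s p \<Omega> u x +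
          ennreal ((C2 * \<sigma>) powr (q / p)) \<partial>?X)"
        unfolding A(2)[symmetric]
      proof (rule nn_integral_mono)
        fix x assume "x \<in> space ?X"
        then have x: "x \<in> \<Omega>" by (simp add: space_restrict_space)
        show "ennreal (u x powr q) \<le> ennreal (C1 * A powr \<kappa>) * frac_energy s p \<Omega> u x +
          ennreal ((C2 * \<sigma>) powr (q / p))"
          using critical_pointwise_bound[OF u _ x s p sp q eq_refl[OF A(2)] A0 M] u0 K \<sigma>
          by (simp add: C1_def \<kappa>_def N_def[symmetric] const)
      qed
      also have "\<dots> = ennreal (C1 * A powr \<kappa>) * (\<integral>\<^sup>+x. frac_energy s p \<Omega> u x \<partial>?X) +
          ennreal ((C2 * \<sigma>) powr (q / p)) * ennreal m"
        using m(1) by (simp add: nn_integral_add nn_integral_cmult space_restrict_space)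
      also have "\<dots> \<le> ennreal (C1 * A powr \<kappa>) * ennreal \<sigma> +
          ennreal ((C2 * \<sigma>) powr (q / p)) * ennreal m"
        by (intro add_mono mult_left_mono U) auto
      also have "\<dots> = ennreal (C1 * A powr \<kappa> * \<sigma> + (C2 * \<sigma>) powr (q / p) * m)"
        using C1 \<sigma> m by (simp add: ennreal_mult)
      finally have le: "A \<le> C1 * A powr \<kappa> * \<sigma> + (C2 * \<sigma>) powr (q / p) * m"
        using C1 \<sigma> m by (subst (asm) ennreal_le_iff) auto
      \<comment> \<open>One of the two summands in \<open>le\<close> is at least
        \<open>A / 2\<close>; \<open>C\<close> is the sum of the constants of the two cases.\<close>
      have "A \<le> (2 * C1) powr (q / p) * \<sigma> powr (q / p) \<or>
            A \<le> 2 * m * C2 powr (q / p) * \<sigma> powr (q / p)"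
      proof (cases "A / 2 \<le> C1 * A powr \<kappa> * \<sigma>")
        case True
        have "A powr (1 - \<kappa>) * A powr \<kappa> = A" using A0 by (simp add: powr_add[symmetric])
        then have "A powr (1 - \<kappa>) * A powr \<kappa> \<le> (2 * C1 * \<sigma>) * A powr \<kappa>"
          using True by (simp add: algebra_simps)
        then have "A powr (1 - \<kappa>) \<le> 2 * C1 * \<sigma>"
          using A0 by simp
        then have "(A powr (1 - \<kappa>)) powr (q / p) \<le> (2 * C1 * \<sigma>) powr (q / p)"
          using q0 p by (intro powr_mono2) auto
        moreover have "(A powr (1 - \<kappa>)) powr (q / p) = A"
          unfolding powr_powr q1 using A0 by simp
        ultimately show ?thesis using C1 \<sigma> by (simp add: powr_mult)
      next
        case False
        then have "A \<le> 2 * ((C2 * \<sigma>) powr (q / p) * m)" using le by linarith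
        then show ?thesis using C2 \<sigma> by (simp add: powr_mult mult_ac)
      qed
      moreover have "0 \<le> (2 * C1) powr (q / p) * \<sigma> powr (q / p)"
        "0 \<le> 2 * m * C2 powr (q / p) * \<sigma> powr (q / p)" using m by auto
      ultimately have "A \<le> C * \<sigma> powr (q / p)"
        unfolding C_def distrib_right by linarith
      then show ?thesis unfolding A(2) by (rule ennreal_leI)
    qed
  qed
  then show ?thesis using C by blast
qed

text \<open>The constant in the bounded case does not depend on the bound \<open>T\<close>.
  Truncations \<open>min u n\<close> do not increase the energy or the integral of
  \<open>u powr p\<close>, so the estimate passes to \<open>u\<close> by monotone
  convergence.\<close>

lemma critical_bound:
  assumes s: "0 < s" and p: "1 \<le> p" and sp: "s * p < real DIM('a)"
    and q: "q = real DIM('a) * p / (real DIM('a) - s * p)" and K: "0 \<le> K"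
  shows "\<exists>C>0. \<forall>u :: 'a \<Rightarrow> real. \<forall>\<sigma>. u \<in> borel_measurable (lebesgue_on \<Omega>) \<longrightarrow>
     (\<forall>x. 0 \<le> u x) \<longrightarrow> 0 < \<sigma> \<longrightarrow>
     (\<integral>\<^sup>+x. frac_energy s p \<Omega> u x \<partial>lebesgue_on \<Omega>) \<le> ennreal \<sigma> \<longrightarrow>
     (\<integral>\<^sup>+x. ennreal (u x powr p) \<partial>lebesgue_on \<Omega>) \<le> ennreal (K * \<sigma>) \<longrightarrow>
     (\<integral>\<^sup>+x. ennreal (u x powr q) \<partial>lebesgue_on \<Omega>) \<le> ennreal (C * \<sigma> powr (q / p))"
proof -
  let ?X = "lebesgue_on \<Omega>"
  obtain C where C: "C > 0" and bounded: "\<And>(u :: 'a \<Rightarrow> real) T \<sigma>. u \<in> borel_measurable ?X \<Longrightarrow>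
     (\<forall>x. 0 \<le> u x \<and> u x \<le> T) \<Longrightarrow> 0 < \<sigma> \<Longrightarrow>
     (\<integral>\<^sup>+x. frac_energy s p \<Omega> u x \<partial>?X) \<le> ennreal \<sigma> \<Longrightarrow>
     (\<integral>\<^sup>+x. ennreal (u x powr p) \<partial>?X) \<le> ennreal (K * \<sigma>) \<Longrightarrow>
     (\<integral>\<^sup>+x. ennreal (u x powr q) \<partial>?X) \<le> ennreal (C * \<sigma> powr (q / p))"
    using critical_bound_bounded[OF s p sp q K] by blast
  have q0: "q > 0" using p sp by (simp add: q)
  have "(\<integral>\<^sup>+x. ennreal (u x powr q) \<partial>?X) \<le> ennreal (C * \<sigma> powr (q / p))"
    if u[measurable]: "u \<in> borel_measurable ?X" and u0: "\<forall>x. 0 \<le> u x" and \<sigma>: "0 < \<sigma>"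
      and U: "(\<integral>\<^sup>+x. frac_energy s p \<Omega> u x \<partial>?X) \<le> ennreal \<sigma>"
      and M: "(\<integral>\<^sup>+x. ennreal (u x powr p) \<partial>?X) \<le> ennreal (K * \<sigma>)"
    for u :: "'a \<Rightarrow> real" and \<sigma>
  proof -
    let ?u = "\<lambda>n x. min (u x) (real n)"
    have "(\<integral>\<^sup>+x. ennreal (?u n x powr q) \<partial>?X) \<le> ennreal (C * \<sigma> powr (q / p))" for n
    proof (rule bounded[where T = "real n"])
      show "\<forall>x. 0 \<le> ?u n x \<and> ?u n x \<le> real n" using u0 by auto
      have "(\<integral>\<^sup>+x. frac_energy s p \<Omega> (?u n) x \<partial>?X) \<le> (\<integral>\<^sup>+x. frac_energy s p \<Omega> u x \<partial>?X)"
        using p by (intro nn_integral_mono frac_energy_mono) auto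
      then show "(\<integral>\<^sup>+x. frac_energy s p \<Omega> (?u n) x \<partial>?X) \<le> ennreal \<sigma>" using U by order
      have "(\<integral>\<^sup>+x. ennreal (?u n x powr p) \<partial>?X) \<le> (\<integral>\<^sup>+x. ennreal (u x powr p) \<partial>?X)"
        using p u0 by (intro nn_integral_mono ennreal_leI powr_mono2) auto
      then show "(\<integral>\<^sup>+x. ennreal (?u n x powr p) \<partial>?X) \<le> ennreal (K * \<sigma>)" using M by order
    qed (use \<sigma> in \<open>auto\<close>)
    moreover have "(\<lambda>n. \<integral>\<^sup>+x. ennreal (?u n x powr q) \<partial>?X) \<longlonglongrightarrow> (\<integral>\<^sup>+x. ennreal (u x powr q) \<partial>?X)"
    proof (rule nn_integral_LIMSEQ)
      show "incseq (\<lambda>n x. ennreal (?u n x powr q))"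
        using u0 q0 by (auto simp: incseq_def le_fun_def intro!: ennreal_leI powr_mono2)
      fix x
      obtain m where m: "u x \<le> real m" using real_arch_simple by blast
      have "\<forall>\<^sub>F n in sequentially. ennreal (?u n x powr q) = ennreal (u x powr q)"
        using eventually_ge_at_top[of m] by eventually_elim (use m in \<open>auto simp: min_def\<close>)
      then show "(\<lambda>n. ennreal (?u n x powr q)) \<longlonglongrightarrow> ennreal (u x powr q)"
        by (rule tendsto_eventually)
    qed auto
    ultimately show ?thesis by (intro LIMSEQ_le_const2) auto
  qed
  then show ?thesis using C by blast
qed

text \<open>
  A De Giorgi iteration: the superlevel sets at the levels \<open>\<tau> * H + (\<Sum>j<k. h j)\<close> have measure at most
  \<open>c / 2 * (r k) powr N\<close>, where the radii \<open>r k = R / 2 ^ k\<close> tend to \<open>0\<close> but the level gaps \<open>h k\<close>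
  are summable since \<open>s * p > N\<close>.
\<close>

lemma supercritical_bound:
  assumes s: "0 < s" and p: "1 \<le> p" and sp: "real DIM('a) < s * p" and K: "0 \<le> K"
  shows "\<exists>C>0. \<forall>u :: 'a \<Rightarrow> real. \<forall>\<sigma>. u \<in> borel_measurable (lebesgue_on \<Omega>) \<longrightarrow> 0 < \<sigma> \<longrightarrow>
     (\<integral>\<^sup>+x. frac_energy s p \<Omega> u x \<partial>lebesgue_on \<Omega>) \<le> ennreal \<sigma> \<longrightarrow>
     (\<integral>\<^sup>+x. ennreal (u x powr p) \<partial>lebesgue_on \<Omega>) \<le> ennreal (K * \<sigma>) \<longrightarrow>
     (AE x in lebesgue_on \<Omega>. u x \<le> C * \<sigma> powr (1 / p))"
proof -
  let ?X = "lebesgue_on \<Omega>"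
  define N where "N = real DIM('a)"
  define r where "r = (\<lambda>k. R * (1/2) ^ k)"
  \<comment> \<open>\<open>G\<close> and \<open>\<eta>\<close> make \<open>h k\<close> proportional
    to \<open>r k powr ((s * p - N) / p)\<close>, with the factor for which the level estimate
    reproduces itself from \<open>k\<close> to \<open>k + 1\<close>. The condition
    \<open>s * p > N\<close> gives \<open>\<eta> < 1\<close>.\<close>
  define G where "G = ((2 / c)\<^sup>2 * 2 powr N * R powr (s * p - N)) powr (1 / p)"
  define \<eta> where "\<eta> = (1/2 :: real) powr ((s * p - N) / p)"
  \<comment> \<open>Chosen so that Markov's inequality at level \<open>\<tau> * H\<close> starts the
    induction at radius \<open>R\<close>; \<open>K + 1\<close> keeps \<open>H\<close> positive for
    \<open>K = 0\<close>.\<close>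
  define H where "H = ((K + 1) / (c / 2 * R powr N)) powr (1 / p)"
  define C where "C = H + G / (1 - \<eta>)"
  have N: "N > 0" by (simp add: N_def)
  have r: "0 < r k" "r k \<le> R" for k
    using R_pos by (auto simp: r_def mult_le_cancel_left1 power_le_one)
  have \<eta>: "0 < \<eta>" "\<eta> < 1"
    using sp p powr_less_mono'[of "1/2" 0 "(s * p - N) / p"] by (auto simp: \<eta>_def N_def)
  have G: "G > 0" using c_pos R_pos by (simp add: G_def)
  have H: "H > 0" using c_pos R_pos K by (simp add: H_def)
  have C: "C > 0" using G H \<eta> by (simp add: C_def add_pos_pos)
  have "AE x in ?X. u x \<le> C * \<sigma> powr (1 / p)"
    if u[measurable]: "u \<in> borel_measurable ?X" and \<sigma>: "0 < \<sigma>"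
      and U: "(\<integral>\<^sup>+x. frac_energy s p \<Omega> u x \<partial>?X) \<le> ennreal \<sigma>"
      and M: "(\<integral>\<^sup>+x. ennreal (u x powr p) \<partial>?X) \<le> ennreal (K * \<sigma>)"
    for u :: "'a \<Rightarrow> real" and \<sigma>
  proof -
    define \<tau> where "\<tau> = \<sigma> powr (1 / p)"
    define h where "h = (\<lambda>k. \<tau> * G * \<eta> ^ k)"
    define l where "l = (\<lambda>k. \<tau> * H + (\<Sum>j<k. h j))"
    have \<tau>: "\<tau> > 0" "\<tau> powr p = \<sigma>" using \<sigma> p by (auto simp: \<tau>_def powr_powr)
    have h: "h k > 0" for k using \<tau> G \<eta> by (simp add: h_def)
    have h_powr: "h k powr p = (2 / c)\<^sup>2 * 2 powr N * \<sigma> * r k powr (s * p - N)" for k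
    proof -
      have "(\<eta> ^ k) powr p = ((1/2) ^ k) powr (s * p - N)"
        using p by (simp add: \<eta>_def powr_powr mult.commute flip: powr_realpow)
      moreover have "G powr p = (2 / c)\<^sup>2 * 2 powr N * R powr (s * p - N)"
        using c_pos R_pos p by (simp add: G_def powr_powr)
      ultimately show ?thesis
        using \<tau> G \<eta> R_pos by (simp add: h_def r_def powr_mult)
    qed
    have [measurable]: "frac_energy s p \<Omega> u \<in> borel_measurable ?X"
      by (rule measurable_frac_energy[OF lmeasurable u])
    have sets[measurable]: "{x\<in>\<Omega>. t < u x} \<in> sets ?X" for t
      using u[unfolded borel_measurable_iff_greater] by (simp add: space_restrict_space)
    have level: "emeasure ?X {x\<in>\<Omega>. l k < u x} \<le> ennreal (c / 2 * r k powr N)" for k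
    proof (induction k)
      case 0
      have "emeasure ?X {x\<in>\<Omega>. l 0 < u x} \<le> ennreal (K * \<sigma> / (l 0) powr p)"
        using \<tau> H p M by (intro emeasure_superlevel_le sets_lebesgue u) (auto simp: l_def)
      also have "K * \<sigma> / (l 0) powr p = K / (K + 1) * (c / 2 * R powr N)"
        using \<tau> H p K \<sigma> c_pos R_pos by (simp add: l_def powr_mult H_def powr_powr)
      also have "ennreal \<dots> \<le> ennreal (1 * (c / 2 * R powr N))"
        using K c_pos by (intro ennreal_leI mult_right_mono) auto
      finally show ?case by (simp add: r_def)
    next
      case (Suc k)
      let ?E = "{x\<in>\<Omega>. l (Suc k) < u x}"
      have l_Suc: "l (Suc k) = l k + h k" by (simp add: l_def)
      have hp: "h k powr p > 0" using h[of k] by simp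
      have "ennreal (h k powr p) * emeasure ?X ?E = (\<integral>\<^sup>+x. ennreal (h k powr p) * indicator ?E x \<partial>?X)"
        by (simp add: nn_integral_cmult_indicator)
      \<comment> \<open>On \<open>?E\<close> the function exceeds \<open>l k\<close> by at least
        \<open>h k\<close>, so the level gap estimate at radius \<open>r k\<close> applies by the
        induction hypothesis.\<close>
      also have "\<dots> \<le> (\<integral>\<^sup>+x. ennreal (2 / c * r k powr (s * p)) * frac_energy s p \<Omega> u x \<partial>?X)"
      proof (rule nn_integral_mono)
        fix x
        have "ennreal (h k powr p) \<le> ennreal (2 / c * r k powr (s * p)) * frac_energy s p \<Omega> u x"
          if "x \<in> ?E"
          using that h r s p Suc l_Suc
          by (intro frac_energy_ge_level_gap[where l = "l k"] u) (auto simp: N_def)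
        then show "ennreal (h k powr p) * indicator ?E x
            \<le> ennreal (2 / c * r k powr (s * p)) * frac_energy s p \<Omega> u x"
          by (simp add: indicator_def)
      qed
      also have "\<dots> = ennreal (2 / c * r k powr (s * p)) * (\<integral>\<^sup>+x. frac_energy s p \<Omega> u x \<partial>?X)"
        by (rule nn_integral_cmult) measurable
      also have "\<dots> \<le> ennreal (2 / c * r k powr (s * p)) * ennreal \<sigma>"
        by (intro mult_left_mono U) auto
      also have "\<dots> = ennreal (2 / c * r k powr (s * p) * \<sigma>)"
        using \<sigma> by (intro ennreal_mult''[symmetric]) simp
      finally have "ennreal (h k powr p) * emeasure ?X ?E \<le> ennreal (2 / c * r k powr (s * p) * \<sigma>)" .
      then have "emeasure ?X ?E \<le> ennreal (2 / c * r k powr (s * p) * \<sigma> / h k powr p)"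
        by (rule ennreal_le_divideI[OF hp])
      also have "2 / c * r k powr (s * p) * \<sigma> / h k powr p = c / 2 * r (Suc k) powr N"
      proof -
        have "r (Suc k) powr N = r k powr N / 2 powr N"
          using r(1)[of k] by (simp add: r_def powr_divide[symmetric])
        moreover have "r k powr (s * p) = r k powr (s * p - N) * r k powr N"
          by (simp add: powr_add[symmetric])
        moreover have "r k powr (s * p - N) > 0" using r(1)[of k] by simp
        ultimately show ?thesis
          unfolding h_powr using \<sigma> c_pos by (simp add: power2_eq_square field_simps)
      qed
      finally show ?case .
    qed
    have l_le: "l k \<le> C * \<tau>" for k
    proof -
      \<comment> \<open>The geometric series keeps all levels below \<open>C * \<tau>\<close>, so
        the superlevel set at \<open>C * \<tau>\<close> lies in every one of the shrinking
        sets.\<close>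
      have "(\<Sum>j<k. \<eta> ^ j) \<le> 1 / (1 - \<eta>)"
        using \<eta> by (simp add: sum_gp_strict divide_right_mono)
      then have "\<tau> * G * (\<Sum>j<k. \<eta> ^ j) \<le> \<tau> * G * (1 / (1 - \<eta>))"
        using \<tau> G by (intro mult_left_mono) auto
      then show ?thesis by (simp add: l_def h_def C_def sum_distrib_left algebra_simps)
    qed
    have "emeasure ?X {x\<in>\<Omega>. C * \<tau> < u x} \<le> ennreal (c / 2 * r k powr N)" for k
    proof -
      have "emeasure ?X {x\<in>\<Omega>. C * \<tau> < u x} \<le> emeasure ?X {x\<in>\<Omega>. l k < u x}"
        using l_le[of k] by (intro emeasure_mono) auto
      then show ?thesis using level[of k] by order
    qed
    moreover have "(\<lambda>k. ennreal (c / 2 * r k powr N)) \<longlonglongrightarrow> ennreal 0"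
    proof (rule tendsto_ennrealI)
      have "r \<longlonglongrightarrow> R * 0"
        unfolding r_def by (intro tendsto_mult tendsto_const LIMSEQ_power_zero) simp
      then have "r \<longlonglongrightarrow> 0" by simp
      then have "(\<lambda>k. r k powr N) \<longlonglongrightarrow> 0 powr N"
        by (rule tendsto_powr'[OF _ tendsto_const]) (use N r in \<open>auto simp: less_imp_le\<close>)
      then show "(\<lambda>k. c / 2 * r k powr N) \<longlonglongrightarrow> 0"
        by (auto intro: tendsto_mult_right_zero)
    qed
    ultimately have "emeasure ?X {x\<in>\<Omega>. C * \<tau> < u x} \<le> ennreal 0"
      by (intro LIMSEQ_le_const) auto
    then show ?thesis
      unfolding \<tau>_def[symmetric]
      by (intro AE_I[where N = "{x\<in>\<Omega>. C * \<tau> < u x}"]) (auto simp: space_restrict_space)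
  qed
  then show ?thesis using C by blast
qed

text \<open>On a set of finite measure the critical bound yields every smaller exponent, by
  splitting at a threshold \<open>t\<close>: \<open>u powr q\<close> is at most
  \<open>t powr q\<close> below it and at most \<open>t powr (q - q0) * u powr q0\<close> above
  it.\<close>

lemma subcritical_bound:
  assumes s: "0 < s" and p: "1 \<le> p" and sp: "s * p < real DIM('a)"
    and q: "0 < q" "q \<le> real DIM('a) * p / (real DIM('a) - s * p)" and K: "0 \<le> K"
  shows "\<exists>C>0. \<forall>u :: 'a \<Rightarrow> real. \<forall>\<sigma>. u \<in> borel_measurable (lebesgue_on \<Omega>) \<longrightarrow>
     (\<forall>x. 0 \<le> u x) \<longrightarrow> 0 < \<sigma> \<longrightarrow>
     (\<integral>\<^sup>+x. frac_energy s p \<Omega> u x \<partial>lebesgue_on \<Omega>) \<le> ennreal \<sigma> \<longrightarrow>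
     (\<integral>\<^sup>+x. ennreal (u x powr p) \<partial>lebesgue_on \<Omega>) \<le> ennreal (K * \<sigma>) \<longrightarrow>
     (\<integral>\<^sup>+x. ennreal (u x powr q) \<partial>lebesgue_on \<Omega>) \<le> ennreal (C * \<sigma> powr (q / p))"
proof -
  let ?X = "lebesgue_on \<Omega>"
  define q0 where "q0 = real DIM('a) * p / (real DIM('a) - s * p)"
  obtain C where C: "C > 0" and crit: "\<And>(u :: 'a \<Rightarrow> real) \<sigma>. u \<in> borel_measurable ?X \<Longrightarrow>
     (\<forall>x. 0 \<le> u x) \<Longrightarrow> 0 < \<sigma> \<Longrightarrow>
     (\<integral>\<^sup>+x. frac_energy s p \<Omega> u x \<partial>?X) \<le> ennreal \<sigma> \<Longrightarrow>
     (\<integral>\<^sup>+x. ennreal (u x powr p) \<partial>?X) \<le> ennreal (K * \<sigma>) \<Longrightarrow>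
     (\<integral>\<^sup>+x. ennreal (u x powr q0) \<partial>?X) \<le> ennreal (C * \<sigma> powr (q0 / p))"
    using critical_bound[OF s p sp q0_def K] by blast
  define m where "m = enn2real (emeasure ?X (space ?X))"
  have m: "emeasure ?X (space ?X) = ennreal m" "0 \<le> m"
    using emeasure_space_finite by (auto simp: m_def less_top)
  have "(\<integral>\<^sup>+x. ennreal (u x powr q) \<partial>?X) \<le> ennreal ((m + C) * \<sigma> powr (q / p))"
    if u[measurable]: "u \<in> borel_measurable ?X" and u0: "\<forall>x. 0 \<le> u x" and \<sigma>: "0 < \<sigma>"
      and U: "(\<integral>\<^sup>+x. frac_energy s p \<Omega> u x \<partial>?X) \<le> ennreal \<sigma>"
      and M: "(\<integral>\<^sup>+x. ennreal (u x powr p) \<partial>?X) \<le> ennreal (K * \<sigma>)"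
    for u :: "'a \<Rightarrow> real" and \<sigma>
  proof -
    \<comment> \<open>With this threshold both parts scale like
      \<open>\<sigma> powr (q / p)\<close>.\<close>
    define t where "t = \<sigma> powr (1 / p)"
    have t: "t > 0" "t powr q = \<sigma> powr (q / p)" "t powr q0 = \<sigma> powr (q0 / p)"
      using \<sigma> by (auto simp: t_def powr_powr)
    have pw: "u x powr q \<le> t powr q + t powr (q - q0) * u x powr q0" for x
    proof (cases "u x \<le> t")
      case True
      then have "u x powr q \<le> t powr q" using u0 q by (intro powr_mono2) auto
      then show ?thesis by (simp add: add_increasing2)
    next
      case False
      have "u x powr (q - q0) \<le> t powr (q - q0)"
        using False t q by (intro powr_mono2') (auto simp: q0_def)
      then have "u x powr (q - q0) * u x powr q0 \<le> t powr (q - q0) * u x powr q0"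
        by (rule mult_right_mono) simp
      then show ?thesis by (simp add: powr_add[symmetric] add_increasing)
    qed
    have "(\<integral>\<^sup>+x. ennreal (u x powr q) \<partial>?X) \<le>
        (\<integral>\<^sup>+x. ennreal (t powr q) + ennreal (t powr (q - q0)) * ennreal (u x powr q0) \<partial>?X)"
      using pw by (intro nn_integral_mono) (simp flip: ennreal_mult ennreal_plus)
    also have "\<dots> = ennreal (t powr q) * ennreal m +
        ennreal (t powr (q - q0)) * (\<integral>\<^sup>+x. ennreal (u x powr q0) \<partial>?X)"
      using m(1) by (simp add: nn_integral_add nn_integral_cmult)
    also have "\<dots> \<le> ennreal (t powr q) * ennreal m +
        ennreal (t powr (q - q0)) * ennreal (C * \<sigma> powr (q0 / p))"
      by (intro add_mono mult_left_mono crit) (use u u0 \<sigma> U M in auto)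
    also have "\<dots> = ennreal (t powr q * m + t powr (q - q0) * (C * t powr q0))"
      using m C t by (simp add: ennreal_mult)
    also have "t powr q * m + t powr (q - q0) * (C * t powr q0) = (m + C) * \<sigma> powr (q / p)"
    proof -
      have "t powr (q - q0) * t powr q0 = t powr q" by (simp add: powr_add[symmetric])
      then show ?thesis using t(2) by (simp add: algebra_simps)
    qed
    finally show ?thesis .
  qed
  moreover have "m + C > 0" using m C by simp
  ultimately show ?thesis by blast
qed

text \<open>
  For \<open>s * p \<ge> N\<close> the seminorm of a smaller order \<open>s'\<close> with \<open>s' * p < N\<close> and critical exponent at
  least \<open>q\<close> is controlled because \<open>\<Omega>\<close> is bounded.
\<close>

lemma finite_exponent_bound:
  assumes s: "0 < s" and p: "1 \<le> p" and q: "0 < q"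
    and range: "s * p < real DIM('a) \<Longrightarrow> q \<le> real DIM('a) * p / (real DIM('a) - s * p)"
    and D: "0 < D" "\<And>x y. x \<in> \<Omega> \<Longrightarrow> y \<in> \<Omega> \<Longrightarrow> norm (x - y) \<le> D" and K: "0 \<le> K"
  shows "\<exists>C>0. \<forall>u :: 'a \<Rightarrow> real. \<forall>\<sigma>. u \<in> borel_measurable (lebesgue_on \<Omega>) \<longrightarrow>
     (\<forall>x. 0 \<le> u x) \<longrightarrow> 0 < \<sigma> \<longrightarrow>
     (\<integral>\<^sup>+x. frac_energy s p \<Omega> u x \<partial>lebesgue_on \<Omega>) \<le> ennreal \<sigma> \<longrightarrow>
     (\<integral>\<^sup>+x. ennreal (u x powr p) \<partial>lebesgue_on \<Omega>) \<le> ennreal (K * \<sigma>) \<longrightarrow>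
     (\<integral>\<^sup>+x. ennreal (u x powr q) \<partial>lebesgue_on \<Omega>) \<le> ennreal (C * \<sigma> powr (q / p))"
proof (cases "s * p < real DIM('a)")
  case True
  then show ?thesis using subcritical_bound[OF s p True q range[OF True] K] by blast
next
  case False
  let ?X = "lebesgue_on \<Omega>" and ?N = "real DIM('a)"
  \<comment> \<open>\<open>\<delta>\<close> is the gap \<open>N - s' * p\<close>. The bound
    \<open>N / 2\<close> makes \<open>s'\<close> positive, and \<open>N * p / q\<close> makes the
    critical exponent \<open>N * p / \<delta>\<close> at least \<open>q\<close>.\<close>
  define \<delta> where "\<delta> = min (?N / 2) (?N * p / q)"
  define s' where "s' = (?N - \<delta>) / p"
  have \<delta>: "0 < \<delta>" "\<delta> < ?N" "\<delta> \<le> ?N * p / q"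
    using p q by (auto simp: \<delta>_def min_less_iff_disj)
  have s'p: "s' * p = ?N - \<delta>" using p by (simp add: s'_def)
  have s': "0 < s'" using \<delta> p by (simp add: s'_def)
  have "s' * p \<le> s * p" using False \<delta> s'p by simp
  then have s's: "s' \<le> s" using p by simp
  have q': "q \<le> ?N * p / (?N - s' * p)"
    using \<delta> q unfolding s'p by (simp add: field_simps)
  define E where "E = D powr ((s - s') * p)"
  have E: "E > 0" using D by (simp add: E_def)
  \<comment> \<open>The energy of order \<open>s'\<close> is bounded by \<open>E * \<sigma>\<close>;
    the constant \<open>K / E\<close> compensates, as
    \<open>K / E * (E * \<sigma>) = K * \<sigma>\<close>.\<close>
  obtain C where C: "C > 0" and sub: "\<And>(u :: 'a \<Rightarrow> real) \<sigma>. u \<in> borel_measurable ?X \<Longrightarrow>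
     (\<forall>x. 0 \<le> u x) \<Longrightarrow> 0 < \<sigma> \<Longrightarrow>
     (\<integral>\<^sup>+x. frac_energy s' p \<Omega> u x \<partial>?X) \<le> ennreal \<sigma> \<Longrightarrow>
     (\<integral>\<^sup>+x. ennreal (u x powr p) \<partial>?X) \<le> ennreal (K / E * \<sigma>) \<Longrightarrow>
     (\<integral>\<^sup>+x. ennreal (u x powr q) \<partial>?X) \<le> ennreal (C * \<sigma> powr (q / p))"
    using subcritical_bound[OF s' p _ q q', of "K / E"] s'p \<delta> K E by auto
  have "(\<integral>\<^sup>+x. ennreal (u x powr q) \<partial>?X) \<le> ennreal (C * E powr (q / p) * \<sigma> powr (q / p))"
    if u[measurable]: "u \<in> borel_measurable ?X" and u0: "\<forall>x. 0 \<le> u x" and \<sigma>: "0 < \<sigma>"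
      and U: "(\<integral>\<^sup>+x. frac_energy s p \<Omega> u x \<partial>?X) \<le> ennreal \<sigma>"
      and M: "(\<integral>\<^sup>+x. ennreal (u x powr p) \<partial>?X) \<le> ennreal (K * \<sigma>)"
    for u :: "'a \<Rightarrow> real" and \<sigma>
  proof -
    have "(\<integral>\<^sup>+x. frac_energy s' p \<Omega> u x \<partial>?X) \<le> (\<integral>\<^sup>+x. ennreal E * frac_energy s p \<Omega> u x \<partial>?X)"
    proof (rule nn_integral_mono)
      fix x assume "x \<in> space ?X"
      then have "x \<in> \<Omega>" by (simp add: space_restrict_space)
      then show "frac_energy s' p \<Omega> u x \<le> ennreal E * frac_energy s p \<Omega> u x"
        unfolding E_def using D(2) s's p by (intro frac_energy_lower_order[OF u]) auto
    qed
    also have "\<dots> = ennreal E * (\<integral>\<^sup>+x. frac_energy s p \<Omega> u x \<partial>?X)"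
      by (rule nn_integral_cmult) (rule measurable_frac_energy[OF lmeasurable u])
    also have "\<dots> \<le> ennreal E * ennreal \<sigma>" by (intro mult_left_mono U) simp
    also have "\<dots> = ennreal (E * \<sigma>)" using E by (simp add: ennreal_mult')
    finally have "(\<integral>\<^sup>+x. frac_energy s' p \<Omega> u x \<partial>?X) \<le> ennreal (E * \<sigma>)" .
    then have "(\<integral>\<^sup>+x. ennreal (u x powr q) \<partial>?X) \<le> ennreal (C * (E * \<sigma>) powr (q / p))"
      by (intro sub[OF u u0]) (use \<sigma> E M in auto)
    then show ?thesis using E \<sigma> by (simp add: powr_mult mult.assoc)
  qed
  moreover have "C * E powr (q / p) > 0" using C E by simp
  ultimately show ?thesis by blast
qed

text \<open>The real-valued bounds are applied to \<open>norm (f - c\<^sub>0)\<close> with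
  \<open>\<sigma> = t powr p\<close>, the Poincare inequality supplying the bound on its
  \<open>p\<close>-th power integral. Stating the result for every \<open>t > 0\<close> above the
  seminorm keeps \<open>\<sigma>\<close> positive even when the seminorm is
  \<open>0\<close>.\<close>

lemma sobolev_poincare:
  fixes g :: "'a \<Rightarrow> complex"
  assumes s: "0 < s" and p: "1 \<le> p" and q: "1 \<le> q"
    and conj: "1 / ennreal p + 1 / p' = 1"
    and g: "g \<in> Lp_space (lebesgue_on \<Omega>) p'" and g1: "(LINT x|lebesgue_on \<Omega>. g x) = 1"
    and bounded: "bounded \<Omega>"
    and range: "(s * p < real DIM('a) \<and> q \<le> ennreal (real DIM('a) * p / (real DIM('a) - s * p))) \<or>
         (s * p = real DIM('a) \<and> q < \<infinity>) \<or> (s * p > real DIM('a) \<and> q \<le> \<infinity>)"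
  shows "\<exists>C>0. \<forall>f \<in> Lp_space (lebesgue_on \<Omega>) (ennreal p). \<forall>t>0.
     gagliardo_seminorm s p \<Omega> f \<le> ennreal t \<longrightarrow>
     Lp_norm (lebesgue_on \<Omega>) q (\<lambda>x. f x - (LINT y|lebesgue_on \<Omega>. f y * g y)) \<le> ennreal (C * t)"
proof -
  let ?X = "lebesgue_on \<Omega>"
  let ?c = "\<lambda>f. LINT y|?X. f y * g y"
  obtain B where B: "\<And>x. x \<in> \<Omega> \<Longrightarrow> norm x \<le> B" "B > 0"
    using bounded bounded_pos by blast
  define D where "D = 2 * B"
  have D: "norm (x - y) \<le> D" if "x \<in> \<Omega>" "y \<in> \<Omega>" for x y
    using B(1)[OF that(1)] B(1)[OF that(2)] norm_triangle_ineq4[of x y] by (simp add: D_def)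
  have D0: "D > 0" using B by (simp add: D_def)
  obtain K where K: "K > 0" and poincare: "\<And>f. f \<in> Lp_space ?X (ennreal p) \<Longrightarrow>
     (\<integral>\<^sup>+x. ennreal (norm (f x - ?c f) powr p) \<partial>?X)
       \<le> ennreal K * (\<integral>\<^sup>+x. frac_energy s p \<Omega> f x \<partial>?X)"
    using fractional_poincare[OF lmeasurable D0 D less_imp_le[OF s] p conj g g1] by blast
  have reduction: "(\<lambda>x. norm (f x - ?c f)) \<in> borel_measurable ?X \<and> 0 < t powr p \<and>
      (\<integral>\<^sup>+x. frac_energy s p \<Omega> (\<lambda>x. norm (f x - ?c f)) x \<partial>?X) \<le> ennreal (t powr p) \<and>
      (\<integral>\<^sup>+x. ennreal (norm (f x - ?c f) powr p) \<partial>?X) \<le> ennreal (K * t powr p)"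
    if f: "f \<in> Lp_space ?X (ennreal p)" and t: "t > 0" "gagliardo_seminorm s p \<Omega> f \<le> ennreal t"
    for f t
  proof -
    have fm[measurable]: "f \<in> borel_measurable ?X" using f by (simp add: Lp_space_def)
    have U: "(\<integral>\<^sup>+x. frac_energy s p \<Omega> f x \<partial>?X) \<le> ennreal (t powr p)"
      using t p unfolding gagliardo_seminorm_def nn_integral_frac_energy[OF lmeasurable fm]
      by (subst (asm) root_ennreal_le_iff) auto
    have "(\<integral>\<^sup>+x. frac_energy s p \<Omega> (\<lambda>x. norm (f x - ?c f)) x \<partial>?X) \<le>
        (\<integral>\<^sup>+x. frac_energy s p \<Omega> f x \<partial>?X)"
    proof (intro nn_integral_mono frac_energy_mono)
      fix x y
      show "norm (norm (f x - ?c f) - norm (f y - ?c f)) \<le> norm (f x - f y)"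
        using norm_triangle_ineq3[of "f x - ?c f" "f y - ?c f"] by simp
    qed (use p in simp)
    then have "(\<integral>\<^sup>+x. frac_energy s p \<Omega> (\<lambda>x. norm (f x - ?c f)) x \<partial>?X) \<le> ennreal (t powr p)"
      using U by order
    moreover have "(\<integral>\<^sup>+x. ennreal (norm (f x - ?c f) powr p) \<partial>?X) \<le> ennreal (K * t powr p)"
      using poincare[OF f] mult_left_mono[OF U, of "ennreal K"] K by (simp add: ennreal_mult)
    ultimately show ?thesis using t by auto
  qed
  show ?thesis
  proof (cases "q = \<infinity>")
    case True
    \<comment> \<open>The other two alternatives in \<open>range\<close> bound \<open>q\<close> by a
      finite number or require \<open>q < \<infinity>\<close>.\<close>
    then have "real DIM('a) < s * p" using range by (auto simp: top_unique)
    then obtain C where C: "C > 0" and bd: "\<And>(u :: 'a \<Rightarrow> real) \<sigma>. u \<in> borel_measurable ?X \<Longrightarrow> 0 < \<sigma> \<Longrightarrow>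
     (\<integral>\<^sup>+x. frac_energy s p \<Omega> u x \<partial>?X) \<le> ennreal \<sigma> \<Longrightarrow>
     (\<integral>\<^sup>+x. ennreal (u x powr p) \<partial>?X) \<le> ennreal (K * \<sigma>) \<Longrightarrow>
     AE x in ?X. u x \<le> C * \<sigma> powr (1 / p)"
      using supercritical_bound[OF s p _ less_imp_le[OF K]] by blast
    have "Lp_norm ?X q (\<lambda>x. f x - ?c f) \<le> ennreal (C * t)"
      if f: "f \<in> Lp_space ?X (ennreal p)" and t: "t > 0" "gagliardo_seminorm s p \<Omega> f \<le> ennreal t"
      for f t
    proof -
      have [measurable]: "f \<in> borel_measurable ?X" using f by (simp add: Lp_space_def)
      have "AE x in ?X. norm (f x - ?c f) \<le> C * (t powr p) powr (1 / p)"
        using reduction[OF f t] by (intro bd) auto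
      then have "AE x in ?X. ennreal (norm (f x - ?c f)) \<le> ennreal (C * t)"
        using t p by (auto simp: powr_powr intro: ennreal_leI)
      then show ?thesis using True by (simp add: Lp_norm_def esssup_I)
    qed
    then show ?thesis using C by blast
  next
    case False
    then obtain q' where q': "q = ennreal q'" "1 \<le> q'"
      using q by (cases q) (auto simp flip: ennreal_1)
    have rg: "q' \<le> real DIM('a) * p / (real DIM('a) - s * p)" if "s * p < real DIM('a)"
      using range that q' p by (auto simp: ennreal_le_iff2)
    obtain C where C: "C > 0" and bd: "\<And>(u :: 'a \<Rightarrow> real) \<sigma>. u \<in> borel_measurable ?X \<Longrightarrow>
     (\<forall>x. 0 \<le> u x) \<Longrightarrow> 0 < \<sigma> \<Longrightarrow>
     (\<integral>\<^sup>+x. frac_energy s p \<Omega> u x \<partial>?X) \<le> ennreal \<sigma> \<Longrightarrow>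
     (\<integral>\<^sup>+x. ennreal (u x powr p) \<partial>?X) \<le> ennreal (K * \<sigma>) \<Longrightarrow>
     (\<integral>\<^sup>+x. ennreal (u x powr q') \<partial>?X) \<le> ennreal (C * \<sigma> powr (q' / p))"
      using finite_exponent_bound[OF s p _ rg D0 D less_imp_le[OF K]] q' by force
    have "Lp_norm ?X q (\<lambda>x. f x - ?c f) \<le> ennreal (C powr (1 / q') * t)"
      if f: "f \<in> Lp_space ?X (ennreal p)" and t: "t > 0" "gagliardo_seminorm s p \<Omega> f \<le> ennreal t"
      for f t
    proof -
      have "(\<integral>\<^sup>+x. ennreal (norm (f x - ?c f) powr q') \<partial>?X) \<le> ennreal (C * (t powr p) powr (q' / p))"
        using reduction[OF f t] by (intro bd) auto
      also have "C * (t powr p) powr (q' / p) = (C powr (1 / q') * t) powr q'"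
        using C t p q' by (simp add: powr_mult powr_powr)
      finally show ?thesis
        using q' C t by (simp add: Lp_norm_def root_ennreal_le_iff)
    qed
    moreover have "C powr (1 / q') > 0" using C by simp
    ultimately show ?thesis by blast
  qed
qed

end

theorem theorem1p5:
  fixes \<Omega> :: "'a::euclidean_space set"
    and s p :: real
    and q p' :: ennreal
    and g :: "'a \<Rightarrow> complex"
  assumes "open \<Omega>" and "connected \<Omega>" and "bounded \<Omega>" and "lipschitz_boundary \<Omega>"
    and "0 < s" and "s < 1"
    and "1 \<le> p"
    and "1 \<le> q"
    and "1 / ennreal p + 1 / p' = 1"
    and "g \<in> Lp_space (lebesgue_on \<Omega>) p'"
    and "(LINT x|lebesgue_on \<Omega>. g x) = 1"
    and "(s * p < real DIM('a) \<and> q \<le> ennreal (real DIM('a) * p / (real DIM('a) - s * p))) \<or>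
         (s * p = real DIM('a) \<and> q < \<infinity>) \<or>
         (s * p > real DIM('a) \<and> q \<le> \<infinity>)"
  shows "\<exists>C::real. C > 0 \<and>
           (\<forall>f \<in> frac_sobolev s p \<Omega>.
              Lp_norm (lebesgue_on \<Omega>) q (\<lambda>x. f x - (LINT y|lebesgue_on \<Omega>. f y * g y))
                \<le> ennreal C * gagliardo_seminorm s p \<Omega> f)"
proof -
  obtain c R :: real where "c > 0" "R > 0"
    "\<And>x r. x \<in> \<Omega> \<Longrightarrow> 0 < r \<Longrightarrow> r \<le> R \<Longrightarrow>
       ennreal (c * r powr DIM('a)) \<le> emeasure (lebesgue_on \<Omega>) (\<Omega> \<inter> ball x r)"
    using lipschitz_boundary_measure_density[OF assms(1,3,4)] by blast
  then interpret measure_density \<Omega> c R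
    using assms(1,3) by unfold_locales (auto intro: lmeasurable_open)
  obtain C where C: "C > 0" and bound: "\<And>f t. f \<in> Lp_space (lebesgue_on \<Omega>) (ennreal p) \<Longrightarrow> t > 0 \<Longrightarrow>
     gagliardo_seminorm s p \<Omega> f \<le> ennreal t \<Longrightarrow>
     Lp_norm (lebesgue_on \<Omega>) q (\<lambda>x. f x - (LINT y|lebesgue_on \<Omega>. f y * g y)) \<le> ennreal (C * t)"
    using sobolev_poincare[OF assms(5,7-11,3,12)] by blast
  have "Lp_norm (lebesgue_on \<Omega>) q (\<lambda>x. f x - (LINT y|lebesgue_on \<Omega>. f y * g y))
      \<le> ennreal C * gagliardo_seminorm s p \<Omega> f" if f: "f \<in> frac_sobolev s p \<Omega>" for f
  \<comment> \<open>\<open>bound\<close> needs a positive \<open>t\<close>, but the seminorm may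
    vanish; enlarging it by \<open>e / C\<close> costs exactly \<open>e\<close>.\<close>
  proof (rule ennreal_le_epsilon)
    fix e :: real assume e: "0 < e"
    obtain t where t: "0 \<le> t" "gagliardo_seminorm s p \<Omega> f = ennreal t"
      using f by (cases "gagliardo_seminorm s p \<Omega> f") (auto simp: frac_sobolev_def)
    have "Lp_norm (lebesgue_on \<Omega>) q (\<lambda>x. f x - (LINT y|lebesgue_on \<Omega>. f y * g y))
        \<le> ennreal (C * (t + e / C))"
      using f t e C by (intro bound) (auto simp: frac_sobolev_def add_nonneg_pos simp del: ennreal_plus intro!: ennreal_leI)
    also have "C * (t + e / C) = C * t + e" using C by (simp add: field_simps)
    also have "ennreal (C * t + e) = ennreal C * gagliardo_seminorm s p \<Omega> f + ennreal e"
      using t C e by (simp add: ennreal_mult)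
    finally show "Lp_norm (lebesgue_on \<Omega>) q (\<lambda>x. f x - (LINT y|lebesgue_on \<Omega>. f y * g y))
        \<le> ennreal C * gagliardo_seminorm s p \<Omega> f + ennreal e" .
  qed
  then show ?thesis using C by blast
qed

end
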